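(* The assignments $(S,X,\theta)\mapsto(S,X^{\mathrm{KS}},\theta^{\mathrm{KS}})$ on objects and $(\varphi,f)\mapsto(\varphi,f^{\mathrm{KS}}_\varphi)$ on morphisms form a functor from $\mathbf{ISA}_{\mathbf{pr}}$ to $\mathbf{ISA}_{\mathbf{pr}}$.
   Context: An inverse semigroup is a semigroup $S$ in which every $s$ has a unique $s^*$ with $ss^*s=s$, $s^*ss^*=s^*$; $E(S)$ is its commutative subsemigroup of idempotents; $s\le t$ means $ts^*s=s$. An action $\theta$ of $S$ on a topological space $X$, written $(S,X,\theta)$, is a semigroup homomorphism $s\mapsto\theta_s$ from $S$ to the inverse semigroup of partial bijections of $X$ (bijections between subsets, composed on the largest possible domain) such that, writing $X_e$ for the subset on which $\theta_e$ ($e\in E(S)$) is the identity (so $\theta_s$ is a bijection $X_{s^*s}\to X_{ss^*}$): each $X_e$ is open, each $\theta_s\colon X_{s^*s}\to X_{ss^*}$ is continuous, and $\bigcup_{e\in E(S)}X_e=X$. The space $X^{\mathrm{KS}}$ (for $X$ locally compact Hausdorff): let $\widetilde{X_e}=X_e\sqcup\{\infty_e\}$ be the one-point compactification of $X_e$ (a point $\infty_e$ is added even when $X_e$ is compact). Let $\widetilde{X^{\mathrm{KS}}}$ be the set of $\tau\in\prod_{e\in E(S)}\widetilde{X_e}$ such that (1) if $e_1\le e_2$ and $\tau(e_1)\ne\infty_{e_1}$, then $\tau(e_2)=\tau(e_1)$; (2) if $\tau(e_1)\neq\infty_{e_1}$ and $\tau(e_2)\neq\infty_{e_2}$, then $\tau(e_1e_2)\neq\infty_{e_1e_2}$;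 with the topology induced from the product topology. Set $X^{\mathrm{KS}}=\widetilde{X^{\mathrm{KS}}}\setminus\{\infty\}$, $\infty=(\infty_e)_e$; it is locally compact Hausdorff. The action $\theta^{\mathrm{KS}}$ of $S$ on $X^{\mathrm{KS}}$ is given by $X^{\mathrm{KS}}_e=\{\tau\in X^{\mathrm{KS}}\mid\tau(e)\ne\infty_e\}$ and $\theta^{\mathrm{KS}}_s\colon X^{\mathrm{KS}}_{s^*s}\to X^{\mathrm{KS}}_{ss^*}$, $\theta^{\mathrm{KS}}_s(\tau)(e)=\theta_{es}(\tau(s^*es))$ if $\tau(s^*es)\neq\infty_{s^*es}$ and $\infty_e$ otherwise. Morphisms: a partial map $f\colon Y\supset D_f\to X$ is a continuous map from an open subset $D_f$ of $Y$ to $X$; partial maps $f\colon Z\supset D_f\to Y$ and $g\colon Y\supset D_g\to X$ compose to $g\circ f\colon Z\supset f^{-1}(D_g)\to X$. An action morphism $(\varphi,f)$ from $(S,X,\theta)$ to $(T,Y,\sigma)$ consists of a semigroup homomorphism $\varphi\colon S\to T$ and a partial map $f\colon Y\supset D_f\to X$ such that (i) $f^{-1}(X_e)=Y_{\varphi(e)}$ for each $e\in E(S)$; (ii) $\theta_s(f(y))=f(\sigma_{\varphi(s)}(y))$ for all $s\in S$ and $y\in f^{-1}(X_{s^*s})=Y_{\varphi(s^*s)}$. It is proper if $f\colon D_f\to X$ is proper (preimages of compact sets are compact). $\mathbf{ISA}_{\mathbf{pr}}$ is the category with objects all inverse semigroup actions on locally compact Hausdorff spaces and morphisms all proper action morphisms;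 composition is $(\psi,g)\circ(\varphi,f)=(\psi\circ\varphi,f\circ g)$, where $f\circ g$ is the composition of partial maps. The map $f^{\mathrm{KS}}_\varphi$: for an action morphism $(\varphi,f)$ from $(S,X,\theta)$ to $(T,Y,\sigma)$, define $\widetilde{f^{\mathrm{KS}}_\varphi}\colon\widetilde{Y^{\mathrm{KS}}}\to\widetilde{X^{\mathrm{KS}}}$ by $\widetilde{f^{\mathrm{KS}}_\varphi}(\omega)(e)=f(\omega(\varphi(e)))$ if $\omega(\varphi(e))\ne\infty_{\varphi(e)}$ and $\infty_e$ otherwise ($e\in E(S)$). Let $D_{f^{\mathrm{KS}}_\varphi}=\bigl(\widetilde{f^{\mathrm{KS}}_\varphi}\bigr)^{-1}(X^{\mathrm{KS}})=\bigcup_{e\in E(S)}Y^{\mathrm{KS}}_{\varphi(e)}$, an open subset of $Y^{\mathrm{KS}}$, and let $f^{\mathrm{KS}}_\varphi\colon Y^{\mathrm{KS}}\supset D_{f^{\mathrm{KS}}_\varphi}\to X^{\mathrm{KS}}$ be the restriction. *)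

theory Defs
  imports "HOL-Analysis.Analysis" "HOL-Algebra.Congruence"
begin

section \<open>Inverse semigroups\<close>

record 'a semigroup = "'a partial_object" +
  mult :: "'a \<Rightarrow> 'a \<Rightarrow> 'a" (infixl \<open>\<otimes>\<index>\<close> 70)

definition is_semigroup :: "'a semigroup \<Rightarrow> bool" where
  "is_semigroup S \<longleftrightarrow>
     (\<forall>a\<in>carrier S. \<forall>b\<in>carrier S. a \<otimes>\<^bsub>S\<^esub> b \<in> carrier S) \<and>
     (\<forall>a\<in>carrier S. \<forall>b\<in>carrier S. \<forall>c\<in>carrier S.
        (a \<otimes>\<^bsub>S\<^esub> b) \<otimes>\<^bsub>S\<^esub> c = a \<otimes>\<^bsub>S\<^esub> (b \<otimes>\<^bsub>S\<^esub> c))"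

definition is_star :: "'a semigroup \<Rightarrow> 'a \<Rightarrow> 'a \<Rightarrow> bool" where
  "is_star S s t \<longleftrightarrow> t \<in> carrier S \<and> s \<otimes>\<^bsub>S\<^esub> t \<otimes>\<^bsub>S\<^esub> s = s \<and> t \<otimes>\<^bsub>S\<^esub> s \<otimes>\<^bsub>S\<^esub> t = t"

definition inverse_semigroup :: "'a semigroup \<Rightarrow> bool" where
  "inverse_semigroup S \<longleftrightarrow> is_semigroup S \<and> (\<forall>s\<in>carrier S. \<exists>!t. is_star S s t)"

definition star :: "'a semigroup \<Rightarrow> 'a \<Rightarrow> 'a" where
  "star S s = (THE t. is_star S s t)"

definition idems :: "'a semigroup \<Rightarrow> 'a set" where
  "idems S = {e \<in> carrier S. e \<otimes>\<^bsub>S\<^esub> e = e}"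

definition nat_le :: "'a semigroup \<Rightarrow> 'a \<Rightarrow> 'a \<Rightarrow> bool" where
  "nat_le S s t \<longleftrightarrow> t \<otimes>\<^bsub>S\<^esub> star S s \<otimes>\<^bsub>S\<^esub> s = s"

text \<open>Homomorphisms are extensional, so that equality of homomorphisms is equality on the
  carrier of the source.\<close>

definition semigroup_hom :: "'a semigroup \<Rightarrow> 'b semigroup \<Rightarrow> ('a \<Rightarrow> 'b) set" where
  "semigroup_hom S T = {\<phi> \<in> carrier S \<rightarrow>\<^sub>E carrier T.
     \<forall>a\<in>carrier S. \<forall>b\<in>carrier S. \<phi> (a \<otimes>\<^bsub>S\<^esub> b) = \<phi> a \<otimes>\<^bsub>T\<^esub> \<phi> b}"


section \<open>Inverse semigroup actions\<close>

text \<open>Partial functions are of type \<open>'x \<rightharpoonup> 'y\<close>; the library's \<open>\<circ>\<^sub>m\<close> is composition on the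
  largest possible domain.\<close>

definition partial_bijection :: "'x set \<Rightarrow> ('x \<rightharpoonup> 'x) \<Rightarrow> bool" where
  "partial_bijection X h \<longleftrightarrow> dom h \<subseteq> X \<and> ran h \<subseteq> X \<and> inj_on h (dom h)"

record ('s, 'x) isaction =
  semig :: "'s semigroup"
  tspace :: "'x topology"
  act :: "'s \<Rightarrow> 'x \<rightharpoonup> 'x"

text \<open>The set \<open>X\<^sub>e\<close>.\<close>

definition dom_at :: "('s, 'x) isaction \<Rightarrow> 's \<Rightarrow> 'x set" where
  "dom_at A e = {x. act A e x = Some x}"

definition is_action :: "('s, 'x) isaction \<Rightarrow> bool" where
  "is_action A \<longleftrightarrow> (let S = semig A; X = tspace A; \<theta> = act A in
     inverse_semigroup S \<and>
     (\<forall>s\<in>carrier S. partial_bijection (topspace X) (\<theta> s)) \<and>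
     (\<forall>s\<in>carrier S. \<forall>t\<in>carrier S. \<theta> (s \<otimes>\<^bsub>S\<^esub> t) = \<theta> s \<circ>\<^sub>m \<theta> t) \<and>
     (\<forall>e\<in>idems S. openin X (dom_at A e)) \<and>
     (\<forall>s\<in>carrier S. continuous_map
        (subtopology X (dom_at A (star S s \<otimes>\<^bsub>S\<^esub> s)))
        (subtopology X (dom_at A (s \<otimes>\<^bsub>S\<^esub> star S s)))
        (\<lambda>x. the (\<theta> s x))) \<and>
     (\<Union>e\<in>idems S. dom_at A e) = topspace X)"


section \<open>The category of proper action morphisms\<close>

definition ISA_pr_obj :: "('s, 'x) isaction set" where
  "ISA_pr_obj = {A. is_action A \<and> locally_compact_space (tspace A) \<and> Hausdorff_space (tspace A)}"

definition partial_map :: "'y topology \<Rightarrow> 'x topology \<Rightarrow> ('y \<rightharpoonup> 'x) \<Rightarrow> bool" where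
  "partial_map Y X f \<longleftrightarrow>
     openin Y (dom f) \<and> continuous_map (subtopology Y (dom f)) X (\<lambda>y. the (f y))"

definition preim :: "('y \<rightharpoonup> 'x) \<Rightarrow> 'x set \<Rightarrow> 'y set" where
  "preim f K = {y \<in> dom f. the (f y) \<in> K}"

definition action_morphisms ::
    "('s, 'x) isaction \<Rightarrow> ('t, 'y) isaction \<Rightarrow> (('s \<Rightarrow> 't) \<times> ('y \<rightharpoonup> 'x)) set" where
  "action_morphisms A B = {(\<phi>, f).
     \<phi> \<in> semigroup_hom (semig A) (semig B) \<and>
     partial_map (tspace B) (tspace A) f \<and>
     (\<forall>e\<in>idems (semig A). preim f (dom_at A e) = dom_at B (\<phi> e)) \<and>
     (\<forall>s\<in>carrier (semig A).
        \<forall>y\<in>preim f (dom_at A (star (semig A) s \<otimes>\<^bsub>semig A\<^esub> s)).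
          (act A s \<circ>\<^sub>m f) y = (f \<circ>\<^sub>m act B (\<phi> s)) y)}"

text \<open>The library's \<open>proper_map\<close> is a different notion (a closed map with compact fibres).\<close>

definition proper_partial_map :: "'y topology \<Rightarrow> 'x topology \<Rightarrow> ('y \<rightharpoonup> 'x) \<Rightarrow> bool" where
  "proper_partial_map Y X f \<longleftrightarrow>
     (\<forall>K. compactin X K \<longrightarrow> compactin (subtopology Y (dom f)) (preim f K))"

definition ISA_pr_hom ::
    "('s, 'x) isaction \<Rightarrow> ('t, 'y) isaction \<Rightarrow> (('s \<Rightarrow> 't) \<times> ('y \<rightharpoonup> 'x)) set" where
  "ISA_pr_hom A B =
     {(\<phi>, f) \<in> action_morphisms A B. proper_partial_map (tspace B) (tspace A) f}"

definition ISA_id :: "('s, 'x) isaction \<Rightarrow> ('s \<Rightarrow> 's) \<times> ('x \<rightharpoonup> 'x)" where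
  "ISA_id A = ((\<lambda>s\<in>carrier (semig A). s), Some |` topspace (tspace A))"

text \<open>The composite \<open>n \<circ> m\<close> of \<open>m : A \<rightarrow> B\<close> and \<open>n : B \<rightarrow> C\<close>; the source \<open>A\<close> is needed
  only to make the composite homomorphism extensional.\<close>

definition ISA_comp ::
    "('s, 'x) isaction \<Rightarrow> ('t \<Rightarrow> 'u) \<times> ('z \<rightharpoonup> 'y) \<Rightarrow> ('s \<Rightarrow> 't) \<times> ('y \<rightharpoonup> 'x)
      \<Rightarrow> ('s \<Rightarrow> 'u) \<times> ('z \<rightharpoonup> 'x)" where
  "ISA_comp A n m = (compose (carrier (semig A)) (fst n) (fst m), snd m \<circ>\<^sub>m snd n)"


text \<open>Identities and composites are proper action morphisms.\<close>

lemma is_star_star: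
  assumes "inverse_semigroup S" "s \<in> carrier S"
  shows "is_star S s (star S s)"
  using assms unfolding inverse_semigroup_def star_def by (metis (no_types, lifting) theI')

lemma hom_star:
  assumes "inverse_semigroup S" "inverse_semigroup T" "\<phi> \<in> semigroup_hom S T" "s \<in> carrier S"
  shows "\<phi> (star S s) = star T (\<phi> s)"
proof -
  have st: "is_star S s (star S s)" by (rule is_star_star[OF assms(1,4)])
  have cl: "a \<otimes>\<^bsub>S\<^esub> b \<in> carrier S" if "a \<in> carrier S" "b \<in> carrier S" for a b
    using assms(1) that by (auto simp: inverse_semigroup_def is_semigroup_def)
  have h: "\<phi> (a \<otimes>\<^bsub>S\<^esub> b) = \<phi> a \<otimes>\<^bsub>T\<^esub> \<phi> b" if "a \<in> carrier S" "b \<in> carrier S" for a b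
    using assms(3) that by (auto simp: semigroup_hom_def)
  have car: "\<phi> a \<in> carrier T" if "a \<in> carrier S" for a
    using assms(3) that by (auto simp: semigroup_hom_def)
  have "is_star T (\<phi> s) (\<phi> (star S s))"
    using st assms(4) by (simp add: is_star_def car cl flip: h)
  moreover have "is_star T (\<phi> s) (star T (\<phi> s))"
    by (rule is_star_star[OF assms(2) car[OF assms(4)]])
  moreover have "\<exists>!t. is_star T (\<phi> s) t"
    using assms(2) car[OF assms(4)] by (simp add: inverse_semigroup_def)
  ultimately show ?thesis by blast
qed

lemma ISA_id_in_hom:
  assumes "A \<in> ISA_pr_obj"
  shows "ISA_id A \<in> ISA_pr_hom A A"
proof -
  let ?X = "tspace A" and ?S = "semig A" and ?f = "Some |` topspace (tspace A)"
  have act: "is_action A" using assms by (simp add: ISA_pr_obj_def)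
  have sg: "inverse_semigroup ?S"
    and pb: "\<And>s. s \<in> carrier ?S \<Longrightarrow> partial_bijection (topspace ?X) (act A s)"
    and un: "(\<Union>e\<in>idems ?S. dom_at A e) = topspace ?X"
    using act by (auto simp: is_action_def Let_def)
  have df: "dom ?f = topspace ?X" by (auto simp: restrict_map_def split: if_splits)
  have cl: "a \<otimes>\<^bsub>?S\<^esub> b \<in> carrier ?S" if "a \<in> carrier ?S" "b \<in> carrier ?S" for a b
    using sg that by (auto simp: inverse_semigroup_def is_semigroup_def)
  have pre: "preim ?f K = K \<inter> topspace ?X" for K
    unfolding preim_def df by (auto simp: restrict_map_def)
  have id: "act A s y = (?f \<circ>\<^sub>m act A s) y" if "s \<in> carrier ?S" for s y
    using pb[OF that] by (auto simp: map_comp_def partial_bijection_def restrict_map_def ran_def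
        split: option.splits)
  have "partial_map ?X ?X ?f"
    unfolding partial_map_def df
    by (auto simp: restrict_map_def intro: continuous_map_eq[OF continuous_map_id])
  moreover have "proper_partial_map ?X ?X ?f"
    unfolding proper_partial_map_def pre df
    by (metis Int_absorb2 compactin_subset_topspace subtopology_topspace)
  moreover have "(\<lambda>s\<in>carrier ?S. s) \<in> semigroup_hom ?S ?S"
    using cl by (auto simp: semigroup_hom_def)
  moreover have "preim ?f (dom_at A e) = dom_at A e" if "e \<in> idems ?S" for e
    using that un unfolding pre by blast
  moreover have "(act A s \<circ>\<^sub>m ?f) y = (?f \<circ>\<^sub>m act A s) y"
    if "s \<in> carrier ?S" "y \<in> topspace ?X" for s y
  proof -
    have "(act A s \<circ>\<^sub>m ?f) y = act A s y" using that(2) by (simp add: map_comp_def restrict_map_def)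
    then show ?thesis using id[OF that(1)] by (rule trans)
  qed
  moreover have "(\<lambda>s\<in>carrier ?S. s) s = s" if "s \<in> carrier ?S" for s using that by simp
  moreover have "idems ?S \<subseteq> carrier ?S" by (auto simp: idems_def)
  moreover have "preim ?f K \<subseteq> topspace ?X" for K by (simp add: pre)
  ultimately show ?thesis
    unfolding ISA_id_def ISA_pr_hom_def action_morphisms_def mem_Collect_eq case_prod_conv
    by (metis (no_types, lifting) subsetD)
qed

lemma ISA_comp_in_hom:
  assumes A: "A \<in> ISA_pr_obj" and B: "B \<in> ISA_pr_obj" and C: "C \<in> ISA_pr_obj"
    and m: "m \<in> ISA_pr_hom A B" and n: "n \<in> ISA_pr_hom B C"
  shows "ISA_comp A n m \<in> ISA_pr_hom A C"
proof -
  obtain \<phi> f \<psi> g where mn: "m = (\<phi>, f)" "n = (\<psi>, g)" by fastforce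
  let ?S = "semig A" and ?T = "semig B" and ?U = "semig C"
  let ?X = "tspace A" and ?Y = "tspace B" and ?Z = "tspace C"
  let ?h = "f \<circ>\<^sub>m g" and ?c = "compose (carrier (semig A)) \<psi> \<phi>"
  have sg: "inverse_semigroup ?S" "inverse_semigroup ?T" "inverse_semigroup ?U"
    using A B C by (auto simp: ISA_pr_obj_def is_action_def Let_def)
  have cl: "a \<otimes>\<^bsub>?S\<^esub> b \<in> carrier ?S" if "a \<in> carrier ?S" "b \<in> carrier ?S" for a b
    using sg that by (auto simp: inverse_semigroup_def is_semigroup_def)
  have assoc: "(a \<otimes>\<^bsub>?S\<^esub> b) \<otimes>\<^bsub>?S\<^esub> c = a \<otimes>\<^bsub>?S\<^esub> (b \<otimes>\<^bsub>?S\<^esub> c)"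
    if "a \<in> carrier ?S" "b \<in> carrier ?S" "c \<in> carrier ?S" for a b c
    using sg(1) that unfolding inverse_semigroup_def is_semigroup_def by blast
  have ph: "\<phi> \<in> semigroup_hom ?S ?T" and ps: "\<psi> \<in> semigroup_hom ?T ?U"
    and pf: "partial_map ?Y ?X f" and pg: "partial_map ?Z ?Y g"
    and f1: "\<And>e. e \<in> idems ?S \<Longrightarrow> preim f (dom_at A e) = dom_at B (\<phi> e)"
    and g1: "\<And>e. e \<in> idems ?T \<Longrightarrow> preim g (dom_at B e) = dom_at C (\<psi> e)"
    and f2: "\<And>s y. s \<in> carrier ?S \<Longrightarrow> y \<in> preim f (dom_at A (star ?S s \<otimes>\<^bsub>?S\<^esub> s))
       \<Longrightarrow> (act A s \<circ>\<^sub>m f) y = (f \<circ>\<^sub>m act B (\<phi> s)) y"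
    and g2: "\<And>s y. s \<in> carrier ?T \<Longrightarrow> y \<in> preim g (dom_at B (star ?T s \<otimes>\<^bsub>?T\<^esub> s))
       \<Longrightarrow> (act B s \<circ>\<^sub>m g) y = (g \<circ>\<^sub>m act C (\<psi> s)) y"
    and propf: "proper_partial_map ?Y ?X f" and propg: "proper_partial_map ?Z ?Y g"
    using m n
    unfolding mn ISA_pr_hom_def action_morphisms_def mem_Collect_eq case_prod_conv by blast+
  have phc: "\<phi> s \<in> carrier ?T" if "s \<in> carrier ?S" for s
    using ph that by (auto simp: semigroup_hom_def)
  have phi: "\<phi> e \<in> idems ?T" if "e \<in> idems ?S" for e
  proof -
    have "e \<in> carrier ?S" "e \<otimes>\<^bsub>?S\<^esub> e = e" using that by (auto simp: idems_def)
    moreover have "\<phi> (e \<otimes>\<^bsub>?S\<^esub> e) = \<phi> e \<otimes>\<^bsub>?T\<^esub> \<phi> e"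
      using ph calculation(1) by (simp add: semigroup_hom_def)
    ultimately show ?thesis using phc by (simp add: idems_def)
  qed
  have stc: "star ?S s \<in> carrier ?S" "star ?S s \<otimes>\<^bsub>?S\<^esub> s \<in> idems ?S" if "s \<in> carrier ?S" for s
  proof -
    have st: "is_star ?S s (star ?S s)" by (rule is_star_star[OF sg(1) that])
    then show c: "star ?S s \<in> carrier ?S" by (simp add: is_star_def)
    have "(star ?S s \<otimes>\<^bsub>?S\<^esub> s) \<otimes>\<^bsub>?S\<^esub> (star ?S s \<otimes>\<^bsub>?S\<^esub> s)
        = ((star ?S s \<otimes>\<^bsub>?S\<^esub> s) \<otimes>\<^bsub>?S\<^esub> star ?S s) \<otimes>\<^bsub>?S\<^esub> s"
      using assoc[OF cl[OF c that] c that] by (rule sym)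
    also have "\<dots> = star ?S s \<otimes>\<^bsub>?S\<^esub> s" using st unfolding is_star_def by presburger
    finally show "star ?S s \<otimes>\<^bsub>?S\<^esub> s \<in> idems ?S"
      unfolding idems_def using cl[OF c that] by blast
  qed
  have pre: "preim ?h K = preim g (preim f K)" for K
    by (auto simp: preim_def map_comp_def split: option.splits)
  have dh: "dom ?h = preim g (dom f)"
    by (auto simp: preim_def map_comp_def split: option.splits)
  have gc: "continuous_map (subtopology ?Z (dom g)) ?Y (\<lambda>z. the (g z))" "openin ?Z (dom g)"
    and fc: "continuous_map (subtopology ?Y (dom f)) ?X (\<lambda>y. the (f y))" "openin ?Y (dom f)"
    using pf pg by (auto simp: partial_map_def)
  have "openin (subtopology ?Z (dom g))
      {z \<in> topspace (subtopology ?Z (dom g)). the (g z) \<in> dom f}"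
    using gc(1) fc(2) openin_continuous_map_preimage by blast
  moreover have "{z \<in> topspace (subtopology ?Z (dom g)). the (g z) \<in> dom f} = dom ?h"
    unfolding dh using openin_subset[OF gc(2)] by (auto simp: preim_def)
  ultimately have oh: "openin ?Z (dom ?h)"
    using gc(2) openin_trans_full by metis
  have "continuous_map (subtopology ?Z (dom ?h)) (subtopology ?Y (dom f)) (\<lambda>z. the (g z))"
  proof (rule continuous_map_into_subtopology)
    show "continuous_map (subtopology ?Z (dom ?h)) ?Y (\<lambda>z. the (g z))"
      by (rule continuous_map_from_subtopology_mono[OF gc(1)]) (auto simp: dh preim_def)
  qed (auto simp: dh preim_def)
  from continuous_map_compose[OF this fc(1)]
  have "continuous_map (subtopology ?Z (dom ?h)) ?X (\<lambda>z. the (?h z))"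
    by (rule continuous_map_eq)
       (auto simp: map_comp_def split: option.splits)
  then have ph': "partial_map ?Z ?X ?h" using oh by (simp add: partial_map_def)
  have proph: "proper_partial_map ?Z ?X ?h"
    unfolding proper_partial_map_def
  proof (intro allI impI)
    fix K assume "compactin ?X K"
    then have "compactin ?Y (preim f K)"
      using propf by (auto simp: proper_partial_map_def compactin_subtopology)
    then have "compactin ?Z (preim ?h K)"
      using propg by (auto simp: proper_partial_map_def compactin_subtopology pre)
    moreover have "preim ?h K \<subseteq> dom ?h" by (auto simp: preim_def)
    ultimately show "compactin (subtopology ?Z (dom ?h)) (preim ?h K)"
      by (simp add: compactin_subtopology)
  qed
  have hom: "?c \<in> semigroup_hom ?S ?U"
    using ph ps cl by (auto simp: semigroup_hom_def compose_def PiE_iff Pi_iff)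
  have h1: "preim ?h (dom_at A e) = dom_at C (?c e)" if "e \<in> idems ?S" for e
    using that phi[OF that] f1 g1 by (simp add: pre compose_def idems_def)
  have h2: "(act A s \<circ>\<^sub>m ?h) z = (?h \<circ>\<^sub>m act C (?c s)) z"
    if s: "s \<in> carrier ?S" and z: "z \<in> preim ?h (dom_at A (star ?S s \<otimes>\<^bsub>?S\<^esub> s))" for s z
  proof -
    let ?e = "star ?S s \<otimes>\<^bsub>?S\<^esub> s"
    have z': "z \<in> preim g (preim f (dom_at A ?e))" using z by (simp add: pre)
    then obtain y where y: "g z = Some y" "y \<in> preim f (dom_at A ?e)"
      unfolding preim_def[of g] by auto
    have "\<phi> ?e = star ?T (\<phi> s) \<otimes>\<^bsub>?T\<^esub> \<phi> s"
      using ph s stc(1)[OF s] hom_star[OF sg(1,2) ph s] by (simp add: semigroup_hom_def)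
    then have "z \<in> preim g (dom_at B (star ?T (\<phi> s) \<otimes>\<^bsub>?T\<^esub> \<phi> s))"
      using z' f1[OF stc(2)[OF s]] by simp
    then have e2: "(act B (\<phi> s) \<circ>\<^sub>m g) z = (g \<circ>\<^sub>m act C (\<psi> (\<phi> s))) z"
      using g2 phc s by blast
    have e1: "(act A s \<circ>\<^sub>m f) y = (f \<circ>\<^sub>m act B (\<phi> s)) y" using f2 s y by blast
    have "(act A s \<circ>\<^sub>m ?h) z = (act A s \<circ>\<^sub>m f) y"
      using y(1) by (simp add: map_comp_def)
    also have "\<dots> = (f \<circ>\<^sub>m (act B (\<phi> s) \<circ>\<^sub>m g)) z"
      using e1 y(1) by (simp add: map_comp_def)
    also have "\<dots> = (f \<circ>\<^sub>m (g \<circ>\<^sub>m act C (\<psi> (\<phi> s)))) z"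
      using e2 by (simp add: map_comp_def)
    also have "\<dots> = (?h \<circ>\<^sub>m act C (?c s)) z"
      using s by (simp add: map_comp_def compose_def split: option.splits)
    finally show ?thesis .
  qed
  show ?thesis
    unfolding ISA_comp_def mn ISA_pr_hom_def action_morphisms_def
      mem_Collect_eq case_prod_conv fst_conv snd_conv
    using hom ph' proph h1 h2 by blast
qed


section \<open>The space \<open>X\<^sup>K\<^sup>S\<close> and its action\<close>

text \<open>In \<open>Alexandroff_compactification\<close> the added point \<open>\<infinity>\<^sub>e\<close> is \<open>None\<close>, added also to
  compact spaces. Elements of the product over \<open>E(S)\<close> are extensional functions.\<close>

definition KS_prod :: "('s, 'x) isaction \<Rightarrow> ('s \<Rightarrow> 'x option) topology" where
  "KS_prod A = product_topology
     (\<lambda>e. Alexandroff_compactification (subtopology (tspace A) (dom_at A e))) (idems (semig A))"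

definition KS_tilde :: "('s, 'x) isaction \<Rightarrow> ('s \<Rightarrow> 'x option) set" where
  "KS_tilde A = {\<tau> \<in> topspace (KS_prod A).
     (\<forall>e1\<in>idems (semig A). \<forall>e2\<in>idems (semig A).
        nat_le (semig A) e1 e2 \<and> \<tau> e1 \<noteq> None \<longrightarrow> \<tau> e2 = \<tau> e1) \<and>
     (\<forall>e1\<in>idems (semig A). \<forall>e2\<in>idems (semig A).
        \<tau> e1 \<noteq> None \<and> \<tau> e2 \<noteq> None \<longrightarrow> \<tau> (e1 \<otimes>\<^bsub>semig A\<^esub> e2) \<noteq> None)}"

definition KS_infty :: "('s, 'x) isaction \<Rightarrow> 's \<Rightarrow> 'x option" where
  "KS_infty A = (\<lambda>e\<in>idems (semig A). None)"

definition KS_points :: "('s, 'x) isaction \<Rightarrow> ('s \<Rightarrow> 'x option) set" where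
  "KS_points A = KS_tilde A - {KS_infty A}"

definition KS_dom :: "('s, 'x) isaction \<Rightarrow> 's \<Rightarrow> ('s \<Rightarrow> 'x option) set" where
  "KS_dom A e = {\<tau> \<in> KS_points A. \<tau> e \<noteq> None}"

definition KS_act :: "('s, 'x) isaction \<Rightarrow> 's \<Rightarrow> ('s \<Rightarrow> 'x option) \<rightharpoonup> ('s \<Rightarrow> 'x option)" where
  "KS_act A s \<tau> = (let S = semig A in
     if \<tau> \<in> KS_dom A (star S s \<otimes>\<^bsub>S\<^esub> s)
     then Some (\<lambda>e\<in>idems S.
       (case \<tau> (star S s \<otimes>\<^bsub>S\<^esub> e \<otimes>\<^bsub>S\<^esub> s) of
          None \<Rightarrow> None
        | Some x \<Rightarrow> act A (e \<otimes>\<^bsub>S\<^esub> s) x))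
     else None)"

definition KS_obj :: "('s, 'x) isaction \<Rightarrow> ('s, 's \<Rightarrow> 'x option) isaction" where
  "KS_obj A = \<lparr>semig = semig A,
               tspace = subtopology (KS_prod A) (KS_points A),
               act = KS_act A\<rparr>"

definition KS_map_tilde ::
    "('s, 'x) isaction \<Rightarrow> ('s \<Rightarrow> 't) \<Rightarrow> ('y \<rightharpoonup> 'x) \<Rightarrow> ('t \<Rightarrow> 'y option) \<Rightarrow> 's \<Rightarrow> 'x option" where
  "KS_map_tilde A \<phi> f \<omega> =
     (\<lambda>e\<in>idems (semig A). (case \<omega> (\<phi> e) of None \<Rightarrow> None | Some y \<Rightarrow> f y))"

definition KS_map ::
    "('s, 'x) isaction \<Rightarrow> ('t, 'y) isaction \<Rightarrow> ('s \<Rightarrow> 't) \<Rightarrow> ('y \<rightharpoonup> 'x)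
      \<Rightarrow> ('t \<Rightarrow> 'y option) \<rightharpoonup> ('s \<Rightarrow> 'x option)" where
  "KS_map A B \<phi> f \<omega> =
     (if \<omega> \<in> KS_tilde B \<and> KS_map_tilde A \<phi> f \<omega> \<in> KS_points A
      then Some (KS_map_tilde A \<phi> f \<omega>) else None)"

definition KS_mor ::
    "('s, 'x) isaction \<Rightarrow> ('t, 'y) isaction \<Rightarrow> ('s \<Rightarrow> 't) \<times> ('y \<rightharpoonup> 'x)
      \<Rightarrow> ('s \<Rightarrow> 't) \<times> (('t \<Rightarrow> 'y option) \<rightharpoonup> ('s \<Rightarrow> 'x option))" where
  "KS_mor A B m = (fst m, KS_map A B (fst m) (snd m))"

end

theory Submission
  imports Defs
begin

text \<open>A point of \<open>X\<^sup>K\<^sup>S\<close> is a nonempty filter \<open>F\<close> in the meet semilattice \<open>E(S)\<close> together with a base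
  point \<open>x \<in> \<Inter>\<^bsub>e\<in>F\<^esub> X\<^sub>e\<close>: the indices of the finite coordinates form the filter, and all finite
  coordinates are equal to \<open>x\<close> (lemmas \<open>KS_pt_in_points\<close> and \<open>KS_pointE\<close>). In these terms the action
  and the maps become transparent,
  \<open>\<theta>\<^sup>K\<^sup>S\<^sub>s (F, x) = ({e. s\<^sup>* e s \<in> F}, \<theta>\<^sub>s x)\<close> and \<open>f\<^sup>K\<^sup>S (F, y) = (\<phi>\<inverse> F, f y)\<close>
  (lemmas \<open>KS_act_pt\<close> and \<open>KS_map_pt\<close>), and every algebraic claim, namely the homomorphism property of
  \<open>\<theta>\<^sup>K\<^sup>S\<close>, equivariance, and compatibility with identities and composition, is read off from them.

  The topological claims rest on two facts. First, the set \<open>KS_tilde\<close> of all these points and \<open>\<infinity>\<close> is closed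
  in the product of the one-point compactifications, which is compact Hausdorff because the \<open>X\<^sub>e\<close> are
  locally compact Hausdorff (lemma \<open>closedin_KS_tilde\<close>). So \<open>X\<^sup>K\<^sup>S\<close> is a compact Hausdorff space with
  one point removed. Second, a proper \<open>f\<close> restricts to proper maps
  \<open>Y\<^bsub>\<phi>(e)\<^esub> \<rightarrow> X\<^sub>e\<close>, which extend to the one-point compactifications, so that \<open>f\<^sup>K\<^sup>S\<close> is the restriction of a
  continuous map of the products that sends \<open>\<infinity>\<close> to \<open>\<infinity>\<close>
  (lemma \<open>continuous_map_KS_map_tilde\<close>). This yields continuity of \<open>f\<^sup>K\<^sup>S\<close>, and
  properness as well, since the preimage of a compact set is then closed in a compact space and avoids \<open>\<infinity>\<close>.
  Continuity of \<open>\<theta>\<^sup>K\<^sup>S\<^sub>s\<close> needs a separate argument, as its coordinates need not come from proper maps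
  (lemma \<open>continuous_map_KS_act_coord\<close>).\<close>

section \<open>Idempotents of an inverse semigroup\<close>

locale inv_semigroup =
  fixes S :: "'s semigroup" (structure)
  assumes inverse_semigroup: "inverse_semigroup S"
begin

lemma mult_closed [simp, intro]: "a \<in> carrier S \<Longrightarrow> b \<in> carrier S \<Longrightarrow> a \<otimes> b \<in> carrier S"
  using inverse_semigroup by (auto simp: inverse_semigroup_def is_semigroup_def)

lemma assoc:
  "a \<in> carrier S \<Longrightarrow> b \<in> carrier S \<Longrightarrow> c \<in> carrier S \<Longrightarrow> (a \<otimes> b) \<otimes> c = a \<otimes> (b \<otimes> c)"
  using inverse_semigroup unfolding inverse_semigroup_def is_semigroup_def by blast

lemma star_unique: "s \<in> carrier S \<Longrightarrow> is_star S s t \<Longrightarrow> t = star S s"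
  using inverse_semigroup is_star_star unfolding inverse_semigroup_def by metis

lemma
  assumes "s \<in> carrier S"
  shows star_closed [simp, intro]: "star S s \<in> carrier S"
    and mult_star_mult: "s \<otimes> (star S s \<otimes> s) = s"
    and star_mult_star: "star S s \<otimes> (s \<otimes> star S s) = star S s"
  using is_star_star[OF inverse_semigroup assms] assms
  by (auto simp: is_star_def assoc)

lemma
  assumes "s \<in> carrier S" "t \<in> carrier S"
  shows mult_star_mult_left: "s \<otimes> (star S s \<otimes> (s \<otimes> t)) = s \<otimes> t"
    and star_mult_star_left: "star S s \<otimes> (s \<otimes> (star S s \<otimes> t)) = star S s \<otimes> t"
  using mult_star_mult[OF assms(1)] star_mult_star[OF assms(1)] assms
  by (simp_all flip: assoc)

lemma star_star: "s \<in> carrier S \<Longrightarrow> star S (star S s) = s"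
  by (rule star_unique[symmetric]) (auto simp: is_star_def assoc mult_star_mult star_mult_star)

lemma idem_closed [simp]: "e \<in> idems S \<Longrightarrow> e \<in> carrier S"
  and idem_mult: "e \<in> idems S \<Longrightarrow> e \<otimes> e = e"
  by (auto simp: idems_def)

lemma idemI: "e \<in> carrier S \<Longrightarrow> e \<otimes> e = e \<Longrightarrow> e \<in> idems S"
  unfolding idems_def by blast

lemma idem_mult_left: "e \<in> idems S \<Longrightarrow> a \<in> carrier S \<Longrightarrow> e \<otimes> (e \<otimes> a) = e \<otimes> a"
  by (simp add: idem_mult flip: assoc)

lemma star_idem: "e \<in> idems S \<Longrightarrow> star S e = e"
  by (rule star_unique[symmetric]) (auto simp: is_star_def idem_mult)

text \<open>If \<open>x\<close> is the inverse of \<open>e f\<close>, then \<open>f x e\<close> is another one, so \<open>x = f x e\<close>. This makes \<open>x\<close>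
  idempotent, hence its own inverse, so that \<open>e f = x\<close>.\<close>

lemma idem_closed_mult [simp, intro]:
  assumes e: "e \<in> idems S" and f: "f \<in> idems S"
  shows "e \<otimes> f \<in> idems S"
proof -
  define x where "x = star S (e \<otimes> f)"
  have c: "e \<in> carrier S" "f \<in> carrier S" "x \<in> carrier S"
    using assms by (auto simp: x_def)
  note sm = idem_mult[OF e] idem_mult[OF f] idem_mult_left[OF e] idem_mult_left[OF f]
  have 1: "e \<otimes> (f \<otimes> (x \<otimes> (e \<otimes> f))) = e \<otimes> f" "x \<otimes> (e \<otimes> (f \<otimes> x)) = x"
    using mult_star_mult[of "e \<otimes> f"] star_mult_star[of "e \<otimes> f"] c
    by (simp_all add: x_def assoc)
  have 2: "x \<otimes> (e \<otimes> (f \<otimes> (x \<otimes> e))) = x \<otimes> e"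
    using arg_cong[OF 1(2), of "\<lambda>z. z \<otimes> e"] c by (simp add: assoc)
  have inv: "is_star S (e \<otimes> f) (f \<otimes> (x \<otimes> e))"
    using c 1 2 by (simp add: is_star_def assoc sm)
  have x: "x = f \<otimes> (x \<otimes> e)"
    unfolding x_def by (rule star_unique[OF mult_closed[OF c(1,2)] inv, unfolded x_def, symmetric])
  have "x \<otimes> x = (f \<otimes> (x \<otimes> e)) \<otimes> (f \<otimes> (x \<otimes> e))"
    by (rule arg_cong2[OF x x])
  also have "\<dots> = f \<otimes> (x \<otimes> e)"
    using c 2 by (simp add: assoc)
  also have "\<dots> = x"
    by (rule x[symmetric])
  finally have "x \<in> idems S"
    using c(3) unfolding idems_def by blast
  moreover have "e \<otimes> f = star S x"
    unfolding x_def by (rule star_star[OF mult_closed[OF c(1,2)], symmetric])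
  ultimately show ?thesis
    by (metis star_idem)
qed

text \<open>Both \<open>e f\<close> and \<open>f e\<close> are inverses of the idempotent \<open>e f\<close>, and inverses are unique.\<close>

lemma idem_commute:
  assumes e: "e \<in> idems S" and f: "f \<in> idems S"
  shows "e \<otimes> f = f \<otimes> e"
proof -
  note c = idem_closed[OF e] idem_closed[OF f]
  note sm = idem_mult[OF e] idem_mult[OF f] idem_mult_left[OF e] idem_mult_left[OF f]
  have ef: "e \<otimes> (f \<otimes> (e \<otimes> f)) = e \<otimes> f" "f \<otimes> (e \<otimes> (f \<otimes> e)) = f \<otimes> e"
    using idem_mult[OF idem_closed_mult[OF e f]] idem_mult[OF idem_closed_mult[OF f e]] c
    by (simp_all add: assoc)
  have "is_star S (e \<otimes> f) (f \<otimes> e)"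
    using c ef by (simp add: is_star_def assoc sm)
  from star_unique[OF mult_closed[OF c] this] show ?thesis
    unfolding star_idem[OF idem_closed_mult[OF e f]] by (rule sym)
qed

lemma idem_commute_left:
  assumes "e \<in> idems S" "f \<in> idems S" "a \<in> carrier S"
  shows "e \<otimes> (f \<otimes> a) = f \<otimes> (e \<otimes> a)"
proof -
  have "(e \<otimes> f) \<otimes> a = (f \<otimes> e) \<otimes> a"
    by (simp only: idem_commute[OF assms(1,2)])
  then show ?thesis
    using assms by (simp add: assoc)
qed

lemma star_mult_idem [simp, intro]: "s \<in> carrier S \<Longrightarrow> star S s \<otimes> s \<in> idems S"
  and mult_star_idem [simp, intro]: "s \<in> carrier S \<Longrightarrow> s \<otimes> star S s \<in> idems S"
  by (rule idemI; simp add: assoc star_mult_star_left mult_star_mult_left)+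

lemma nat_le_idem_iff:
  "e \<in> idems S \<Longrightarrow> f \<in> idems S \<Longrightarrow> nat_le S e f \<longleftrightarrow> e \<otimes> f = e"
  unfolding nat_le_def by (metis assoc idem_closed idem_commute idem_mult star_idem)

lemma conj_idem [simp, intro]:
  assumes s: "s \<in> carrier S" and e: "e \<in> idems S"
  shows "star S s \<otimes> e \<otimes> s \<in> idems S"
proof -
  have "star S s \<otimes> (e \<otimes> (s \<otimes> (star S s \<otimes> (e \<otimes> s)))) = star S s \<otimes> (e \<otimes> s)"
    using idem_commute_left[OF e mult_star_idem[OF s], of "e \<otimes> s"] s e
    by (simp add: assoc idem_mult_left star_mult_star_left)
  then show ?thesis
    using s e by (intro idemI) (simp_all add: assoc)
qed

text \<open>Conjugation by \<open>s\<close> is multiplicative on idempotents because \<open>s s\<^sup>*\<close> commutes with them.\<close>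

lemma conj_mult:
  assumes s: "s \<in> carrier S" and e: "e \<in> idems S" and f: "f \<in> idems S"
  shows "star S s \<otimes> (e \<otimes> f) \<otimes> s = (star S s \<otimes> e \<otimes> s) \<otimes> (star S s \<otimes> f \<otimes> s)"
  using idem_commute_left[OF e mult_star_idem[OF s], of "f \<otimes> s"] s e f
  by (simp add: assoc star_mult_star_left)

lemma conj_le:
  assumes s: "s \<in> carrier S" and e: "e \<in> idems S"
  shows "(star S s \<otimes> e \<otimes> s) \<otimes> (star S s \<otimes> s) = star S s \<otimes> e \<otimes> s"
  using s e by (simp add: assoc mult_star_mult)

lemma mult_conj:
  assumes s: "s \<in> carrier S" and e: "e \<in> idems S"
  shows "s \<otimes> (star S s \<otimes> e \<otimes> s) = e \<otimes> s"
  using idem_commute_left[OF e mult_star_idem[OF s], of s] s e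
  by (simp add: assoc mult_star_mult)

text \<open>The product \<open>t\<^sup>* s\<^sup>*\<close> is an inverse of \<open>s t\<close> because \<open>s\<^sup>* s\<close> and \<open>t t\<^sup>*\<close> commute.\<close>

lemma star_mult:
  assumes s: "s \<in> carrier S" and t: "t \<in> carrier S"
  shows "star S (s \<otimes> t) = star S t \<otimes> star S s"
proof (rule star_unique[symmetric])
  have 1: "t \<otimes> (star S t \<otimes> (star S s \<otimes> (s \<otimes> a))) = star S s \<otimes> (s \<otimes> (t \<otimes> (star S t \<otimes> a)))"
    if "a \<in> carrier S" for a
    using idem_commute_left[OF mult_star_idem[OF t] star_mult_idem[OF s] that] s t that
    by (simp add: assoc)
  have 2: "s \<otimes> (t \<otimes> (star S t \<otimes> (star S s \<otimes> (s \<otimes> t)))) = s \<otimes> t"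
    using 1[of t] s t by (simp add: mult_star_mult mult_star_mult_left)
  have 3: "star S t \<otimes> (star S s \<otimes> (s \<otimes> (t \<otimes> (star S t \<otimes> star S s)))) = star S t \<otimes> star S s"
    using 1[of "star S s", symmetric] s t by (simp add: star_mult_star star_mult_star_left)
  show "is_star S (s \<otimes> t) (star S t \<otimes> star S s)"
    using s t 2 3 by (simp add: is_star_def assoc)
qed (use s t in simp)

end


section \<open>Actions by partial bijections\<close>

locale isg_action =
  fixes A :: "('s, 'x) isaction"
  assumes is_action: "is_action A"
begin

abbreviation "S \<equiv> semig A"
abbreviation "E \<equiv> idems S"
abbreviation "X \<equiv> tspace A"
abbreviation "\<theta> \<equiv> act A"
abbreviation "D \<equiv> dom_at A"

sublocale inv_semigroup S
  using is_action by unfold_locales (simp add: is_action_def Let_def)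

lemma act_partial_bijection: "s \<in> carrier S \<Longrightarrow> partial_bijection (topspace X) (\<theta> s)"
  and act_mult: "s \<in> carrier S \<Longrightarrow> t \<in> carrier S \<Longrightarrow> \<theta> (s \<otimes>\<^bsub>S\<^esub> t) = \<theta> s \<circ>\<^sub>m \<theta> t"
  and openin_dom_at: "e \<in> E \<Longrightarrow> openin X (D e)"
  and continuous_map_act: "s \<in> carrier S \<Longrightarrow> continuous_map
        (subtopology X (D (star S s \<otimes>\<^bsub>S\<^esub> s))) (subtopology X (D (s \<otimes>\<^bsub>S\<^esub> star S s)))
        (\<lambda>x. the (\<theta> s x))"
  and Union_dom_at: "(\<Union>e\<in>E. D e) = topspace X"
  using is_action by (simp_all add: is_action_def Let_def)

lemma dom_at_subset: "e \<in> E \<Longrightarrow> D e \<subseteq> topspace X"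
  using Union_dom_at by blast

lemma act_idem:
  assumes "e \<in> E" "\<theta> e x = Some y"
  shows "y = x"
proof -
  have "\<theta> e y = Some y"
    using act_mult[of e e] assms by (simp add: idem_mult map_comp_def fun_eq_iff) (metis option.simps(5))
  then show ?thesis
    using act_partial_bijection[of e] assms
    unfolding partial_bijection_def by (metis domI idem_closed inj_onD)
qed

lemma dom_at_iff: "e \<in> E \<Longrightarrow> x \<in> D e \<longleftrightarrow> \<theta> e x \<noteq> None"
  using act_idem by (auto simp: dom_at_def)

lemma dom_at_mult: "e \<in> E \<Longrightarrow> f \<in> E \<Longrightarrow> D (e \<otimes>\<^bsub>S\<^esub> f) = D e \<inter> D f"
  using act_idem[of e] act_idem[of f]
  by (auto simp: dom_at_def act_mult map_comp_def split: option.splits) blast+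

lemma act_defined_iff:
  assumes "s \<in> carrier S"
  shows "\<theta> s x \<noteq> None \<longleftrightarrow> x \<in> D (star S s \<otimes>\<^bsub>S\<^esub> s)"
proof -
  have "\<theta> s = \<theta> s \<circ>\<^sub>m \<theta> (star S s \<otimes>\<^bsub>S\<^esub> s)"
    using assms act_mult[of s "star S s \<otimes>\<^bsub>S\<^esub> s"] by (simp add: mult_star_mult)
  then have "\<theta> s x \<noteq> None \<Longrightarrow> \<theta> (star S s \<otimes>\<^bsub>S\<^esub> s) x \<noteq> None"
    by (metis map_comp_simps(1))
  moreover have "\<theta> (star S s \<otimes>\<^bsub>S\<^esub> s) x \<noteq> None \<Longrightarrow> \<theta> s x \<noteq> None"
    using assms by (auto simp: act_mult map_comp_def split: option.splits)
  ultimately show ?thesis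
    using assms by (auto simp: dom_at_iff)
qed

lemma act_star:
  assumes "s \<in> carrier S" "\<theta> s x = Some y"
  shows "\<theta> (star S s) y = Some x"
proof -
  have "\<theta> (star S s \<otimes>\<^bsub>S\<^esub> s) x = Some x"
    using act_defined_iff[of s x] assms by (simp add: dom_at_def)
  then show ?thesis
    using assms by (simp add: act_mult map_comp_def)
qed

text \<open>The preimage of \<open>X\<^sub>e\<close> under \<open>\<theta>\<^sub>s\<close> is the set of the conjugate idempotent, because
  \<open>s (s\<^sup>* e s) = e s\<close>.\<close>

lemma act_in_dom_at_iff:
  assumes s: "s \<in> carrier S" and e: "e \<in> E" and y: "\<theta> s x = Some y"
  shows "y \<in> D e \<longleftrightarrow> x \<in> D (star S s \<otimes>\<^bsub>S\<^esub> e \<otimes>\<^bsub>S\<^esub> s)"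
proof
  assume "y \<in> D e"
  then show "x \<in> D (star S s \<otimes>\<^bsub>S\<^esub> e \<otimes>\<^bsub>S\<^esub> s)"
    using s e y act_star[OF s y] by (simp add: dom_at_def act_mult map_comp_def)
next
  assume "x \<in> D (star S s \<otimes>\<^bsub>S\<^esub> e \<otimes>\<^bsub>S\<^esub> s)"
  then have "\<theta> (s \<otimes>\<^bsub>S\<^esub> (star S s \<otimes>\<^bsub>S\<^esub> e \<otimes>\<^bsub>S\<^esub> s)) x = Some y"
    using act_mult[of s "star S s \<otimes>\<^bsub>S\<^esub> e \<otimes>\<^bsub>S\<^esub> s"] s e y by (simp add: dom_at_def map_comp_def)
  then have "\<theta> (e \<otimes>\<^bsub>S\<^esub> s) x = Some y"
    using s e by (simp add: mult_conj)
  then show "y \<in> D e"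
    using s e y by (simp add: act_mult map_comp_def dom_at_def)
qed

lemma act_in_range:
  "s \<in> carrier S \<Longrightarrow> \<theta> s x = Some y \<Longrightarrow> y \<in> D (s \<otimes>\<^bsub>S\<^esub> star S s)"
  using act_in_dom_at_iff[of s "s \<otimes>\<^bsub>S\<^esub> star S s" x y] act_defined_iff[of s x]
  by (simp add: assoc mult_star_mult)


section \<open>Points of \<open>X\<^sup>K\<^sup>S\<close> as filters of idempotents with a base point\<close>

text \<open>The condition on products combines closure under meets with upward closure. In this form it
  says that the indicator function of \<open>F\<close> is multiplicative, so it is inherited by preimages of \<open>F\<close>
  under homomorphisms and under conjugation.\<close>

definition idem_filter :: "'s set \<Rightarrow> bool" where
  "idem_filter F \<longleftrightarrow> F \<subseteq> E \<and> F \<noteq> {} \<and>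
     (\<forall>e\<in>E. \<forall>f\<in>E. e \<otimes>\<^bsub>S\<^esub> f \<in> F \<longleftrightarrow> e \<in> F \<and> f \<in> F)"

definition pointed_filter :: "'s set \<Rightarrow> 'x \<Rightarrow> bool" where
  "pointed_filter F x \<longleftrightarrow> idem_filter F \<and> (\<forall>e\<in>F. x \<in> D e)"

definition KS_pt :: "'s set \<Rightarrow> 'x \<Rightarrow> 's \<Rightarrow> 'x option" where
  "KS_pt F x = (\<lambda>e\<in>E. if e \<in> F then Some x else None)"

lemma KS_pt_apply: "e \<in> E \<Longrightarrow> KS_pt F x e = (if e \<in> F then Some x else None)"
  by (simp add: KS_pt_def)

lemma topspace_KS_prod: "topspace (KS_prod A) = (\<Pi>\<^sub>E e\<in>E. insert None (Some ` D e))"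
proof -
  have "topspace X \<inter> D e = D e" if "e \<in> E" for e
    using dom_at_subset[OF that] by blast
  then show ?thesis
    unfolding KS_prod_def topspace_product_topology
    by (intro PiE_cong) simp
qed

lemma KS_infty_in_tilde: "KS_infty A \<in> KS_tilde A"
  by (auto simp: KS_tilde_def KS_infty_def topspace_KS_prod)

lemma KS_pt_in_points:
  assumes "pointed_filter F x"
  shows "KS_pt F x \<in> KS_points A"
proof -
  have F: "F \<subseteq> E" "F \<noteq> {}" "\<And>e. e \<in> F \<Longrightarrow> x \<in> D e"
    and m: "\<And>e f. e \<in> E \<Longrightarrow> f \<in> E \<Longrightarrow> e \<otimes>\<^bsub>S\<^esub> f \<in> F \<longleftrightarrow> e \<in> F \<and> f \<in> F"
    using assms by (auto simp: pointed_filter_def idem_filter_def)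
  have "KS_pt F x \<in> topspace (KS_prod A)"
    using F by (auto simp: topspace_KS_prod KS_pt_def)
  moreover have "f \<in> F" if "e \<in> E" "f \<in> E" "nat_le S e f" "e \<in> F" for e f
    using that m[of e f] by (simp add: nat_le_idem_iff)
  ultimately have "KS_pt F x \<in> KS_tilde A"
    using m by (simp add: KS_tilde_def KS_pt_apply)
  moreover have "KS_pt F x \<noteq> KS_infty A"
  proof -
    obtain e where "e \<in> F" using F(2) by blast
    then have "KS_pt F x e \<noteq> KS_infty A e"
      using F(1) by (auto simp: KS_pt_apply KS_infty_def)
    then show ?thesis by auto
  qed
  ultimately show ?thesis
    by (simp add: KS_points_def)
qed

text \<open>The finite coordinates of a point form a filter. They all agree, because any two of them agree
  with the coordinate at the product of their indices.\<close>

lemma KS_pointE: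
  assumes "\<tau> \<in> KS_points A"
  obtains F x where "pointed_filter F x" "\<tau> = KS_pt F x"
proof -
  have \<tau>: "\<tau> \<in> KS_tilde A" and ninf: "\<tau> \<noteq> KS_infty A"
    using assms by (simp_all add: KS_points_def)
  then have ext: "\<tau> \<in> (\<Pi>\<^sub>E e\<in>E. insert None (Some ` D e))"
    unfolding KS_tilde_def topspace_KS_prod by blast
  have up: "\<tau> f = \<tau> e" if "e \<in> E" "f \<in> E" "\<tau> e \<noteq> None" "e \<otimes>\<^bsub>S\<^esub> f = e" for e f
    using \<tau> that nat_le_idem_iff[OF that(1,2)] unfolding KS_tilde_def by blast
  have meet: "\<tau> (e \<otimes>\<^bsub>S\<^esub> f) \<noteq> None" if "e \<in> E" "f \<in> E" "\<tau> e \<noteq> None" "\<tau> f \<noteq> None" for e f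
    using \<tau> that unfolding KS_tilde_def by blast
  define F where "F = {e \<in> E. \<tau> e \<noteq> None}"
  have le: "e \<otimes>\<^bsub>S\<^esub> f \<otimes>\<^bsub>S\<^esub> e = e \<otimes>\<^bsub>S\<^esub> f" "e \<otimes>\<^bsub>S\<^esub> f \<otimes>\<^bsub>S\<^esub> f = e \<otimes>\<^bsub>S\<^esub> f" if "e \<in> E" "f \<in> E" for e f
    using that idem_commute[OF that] by (simp_all add: assoc idem_mult idem_mult_left)
  have eq: "\<tau> e = \<tau> (e \<otimes>\<^bsub>S\<^esub> f)" "\<tau> f = \<tau> (e \<otimes>\<^bsub>S\<^esub> f)"
    if "e \<in> E" "f \<in> E" "\<tau> (e \<otimes>\<^bsub>S\<^esub> f) \<noteq> None" for e f
    using that up[OF idem_closed_mult[OF that(1,2)] _ _ le(1)[OF that(1,2)]]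
      up[OF idem_closed_mult[OF that(1,2)] _ _ le(2)[OF that(1,2)]] by auto
  have filt: "e \<otimes>\<^bsub>S\<^esub> f \<in> F \<longleftrightarrow> e \<in> F \<and> f \<in> F" if "e \<in> E" "f \<in> E" for e f
    using that eq[OF that] meet[OF that] by (auto simp: F_def)
  have "F \<noteq> {}"
  proof
    assume "F = {}"
    then have "\<tau> e = KS_infty A e" for e
      using PiE_arb[OF ext, of e] by (cases "e \<in> E") (auto simp: F_def KS_infty_def)
    then have "\<tau> = KS_infty A"
      by (simp add: fun_eq_iff)
    with ninf show False
      by simp
  qed
  then obtain e x where e: "e \<in> F" "\<tau> e = Some x"
    by (auto simp: F_def)
  have val: "\<tau> f = Some x" if "f \<in> F" for f
  proof -
    have "e \<in> E" "f \<in> E" "\<tau> e \<noteq> None" "\<tau> f \<noteq> None"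
      using that e(1) by (simp_all add: F_def)
    then show ?thesis
      using eq[of e f] meet[of e f] e(2) by metis
  qed
  have "\<tau> f = KS_pt F x f" for f
    using PiE_arb[OF ext, of f] val[of f] by (cases "f \<in> E") (auto simp: F_def KS_pt_def)
  then have "\<tau> = KS_pt F x"
    by (simp add: fun_eq_iff)
  moreover have "x \<in> D f" if "f \<in> F" for f
    using val[OF that] that PiE_mem[OF ext, of f] by (auto simp: F_def)
  moreover have "F \<subseteq> E"
    by (auto simp: F_def)
  ultimately show thesis
    using that[of F x] filt \<open>F \<noteq> {}\<close>
    unfolding pointed_filter_def idem_filter_def by blast
qed

lemma pointed_filter_nonempty: "pointed_filter F x \<Longrightarrow> \<exists>e\<in>E. e \<in> F"
  by (auto simp: pointed_filter_def idem_filter_def)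

lemma pointed_filter_subset: "pointed_filter F x \<Longrightarrow> F \<subseteq> E"
  by (auto simp: pointed_filter_def idem_filter_def)

lemma pointed_filter_mult_iff:
  "pointed_filter F x \<Longrightarrow> e \<in> E \<Longrightarrow> f \<in> E \<Longrightarrow> e \<otimes>\<^bsub>S\<^esub> f \<in> F \<longleftrightarrow> e \<in> F \<and> f \<in> F"
  by (auto simp: pointed_filter_def idem_filter_def)

lemma pointed_filter_dom_at: "pointed_filter F x \<Longrightarrow> e \<in> F \<Longrightarrow> x \<in> D e"
  by (auto simp: pointed_filter_def)

lemma pointed_filter_topspace: "pointed_filter F x \<Longrightarrow> x \<in> topspace X"
  using pointed_filter_nonempty[of F x] pointed_filter_dom_at[of F x] dom_at_subset by blast

lemma KS_pt_in_dom_iff: "pointed_filter F x \<Longrightarrow> e \<in> E \<Longrightarrow> KS_pt F x \<in> KS_dom A e \<longleftrightarrow> e \<in> F"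
  using KS_pt_in_points[of F x] by (auto simp: KS_dom_def KS_pt_apply)

lemma KS_pt_eqI:
  "(\<And>e. e \<in> E \<Longrightarrow> e \<in> F \<longleftrightarrow> e \<in> G) \<Longrightarrow> x = y \<Longrightarrow> KS_pt F x = KS_pt G y"
  unfolding KS_pt_def by (intro restrict_ext) simp

lemma KS_domE:
  assumes "\<tau> \<in> KS_dom A e" "e \<in> E"
  obtains F x where "pointed_filter F x" "e \<in> F" "\<tau> = KS_pt F x"
  using assms KS_pointE[of \<tau>] KS_pt_in_dom_iff by (metis (no_types, lifting) KS_dom_def mem_Collect_eq)


section \<open>The action on \<open>X\<^sup>K\<^sup>S\<close>\<close>

lemma pointed_filter_conj_iff:
  assumes "pointed_filter F x" "s \<in> carrier S" "e \<in> E" "f \<in> E"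
  shows "star S s \<otimes>\<^bsub>S\<^esub> (e \<otimes>\<^bsub>S\<^esub> f) \<otimes>\<^bsub>S\<^esub> s \<in> F \<longleftrightarrow>
    star S s \<otimes>\<^bsub>S\<^esub> e \<otimes>\<^bsub>S\<^esub> s \<in> F \<and> star S s \<otimes>\<^bsub>S\<^esub> f \<otimes>\<^bsub>S\<^esub> s \<in> F"
  unfolding conj_mult[OF assms(2-4)]
  using pointed_filter_mult_iff[OF assms(1)] assms by simp

lemma pointed_filter_act:
  assumes F: "pointed_filter F x" and s: "s \<in> carrier S" and sF: "star S s \<otimes>\<^bsub>S\<^esub> s \<in> F"
  shows "pointed_filter {e \<in> E. star S s \<otimes>\<^bsub>S\<^esub> e \<otimes>\<^bsub>S\<^esub> s \<in> F} (the (\<theta> s x))"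
proof -
  obtain y where y: "\<theta> s x = Some y"
    using pointed_filter_dom_at[OF F sF] act_defined_iff[OF s] by blast
  have "s \<otimes>\<^bsub>S\<^esub> star S s \<in> {e \<in> E. star S s \<otimes>\<^bsub>S\<^esub> e \<otimes>\<^bsub>S\<^esub> s \<in> F}"
    using s sF by (simp add: assoc mult_star_mult)
  moreover have "y \<in> D e" if "e \<in> E" "star S s \<otimes>\<^bsub>S\<^esub> e \<otimes>\<^bsub>S\<^esub> s \<in> F" for e
    using act_in_dom_at_iff[OF s that(1) y] pointed_filter_dom_at[OF F that(2)] by blast
  ultimately show ?thesis
    unfolding pointed_filter_def idem_filter_def using pointed_filter_conj_iff[OF F s] y by auto
qed

lemma pointed_filter_conj_imp:
  assumes F: "pointed_filter F x" and s: "s \<in> carrier S" and e: "e \<in> E"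
    and eF: "star S s \<otimes>\<^bsub>S\<^esub> e \<otimes>\<^bsub>S\<^esub> s \<in> F"
  shows "star S s \<otimes>\<^bsub>S\<^esub> s \<in> F"
  using eF pointed_filter_mult_iff[OF F conj_idem[OF s e] star_mult_idem[OF s]]
  by (simp add: conj_le[OF s e])

text \<open>If \<open>s\<^sup>* e s \<in> F\<close>, then \<open>x \<in> X\<^bsub>s\<^sup>*es\<^esub>\<close>, hence \<open>\<theta>\<^sub>s x \<in> X\<^sub>e\<close> and \<open>\<theta>\<^bsub>es\<^esub> x = \<theta>\<^sub>s x\<close>. So the
  finite coordinates of the image are all equal to \<open>\<theta>\<^sub>s x\<close>.\<close>

lemma KS_act_pt:
  assumes F: "pointed_filter F x" and s: "s \<in> carrier S"
  shows "KS_act A s (KS_pt F x) =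
    (if star S s \<otimes>\<^bsub>S\<^esub> s \<in> F
     then Some (KS_pt {e \<in> E. star S s \<otimes>\<^bsub>S\<^esub> e \<otimes>\<^bsub>S\<^esub> s \<in> F} (the (\<theta> s x))) else None)"
proof (cases "star S s \<otimes>\<^bsub>S\<^esub> s \<in> F")
  case True
  obtain y where y: "\<theta> s x = Some y"
    using pointed_filter_dom_at[OF F True] act_defined_iff[OF s] by blast
  have "\<theta> (e \<otimes>\<^bsub>S\<^esub> s) x = Some y" if "e \<in> E" "star S s \<otimes>\<^bsub>S\<^esub> e \<otimes>\<^bsub>S\<^esub> s \<in> F" for e
    using act_in_dom_at_iff[OF s that(1) y] pointed_filter_dom_at[OF F that(2)] s that(1) y
    by (simp add: act_mult map_comp_def dom_at_def)
  then have "(\<lambda>e\<in>E. case KS_pt F x (star S s \<otimes>\<^bsub>S\<^esub> e \<otimes>\<^bsub>S\<^esub> s) of None \<Rightarrow> None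
        | Some x \<Rightarrow> \<theta> (e \<otimes>\<^bsub>S\<^esub> s) x) = KS_pt {e \<in> E. star S s \<otimes>\<^bsub>S\<^esub> e \<otimes>\<^bsub>S\<^esub> s \<in> F} y"
    unfolding KS_pt_def[of _ y] using s by (intro restrict_ext) (simp add: KS_pt_apply)
  then show ?thesis
    using True KS_pt_in_dom_iff[OF F star_mult_idem[OF s]] y by (simp add: KS_act_def Let_def)
next
  case False
  then show ?thesis
    using KS_pt_in_dom_iff[OF F star_mult_idem[OF s]] by (simp add: KS_act_def Let_def)
qed

lemma KS_act_outside: "\<tau> \<notin> KS_points A \<Longrightarrow> KS_act A s \<tau> = None"
  by (simp add: KS_act_def KS_dom_def)

lemma KS_act_idem:
  assumes F: "pointed_filter F x" and e: "e \<in> E" "e \<in> F"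
  shows "KS_act A e (KS_pt F x) = Some (KS_pt F x)"
proof -
  have "KS_act A e (KS_pt F x) = Some (KS_pt {f \<in> E. e \<otimes>\<^bsub>S\<^esub> f \<otimes>\<^bsub>S\<^esub> e \<in> F} x)"
    using KS_act_pt[OF F, of e] e pointed_filter_dom_at[OF F e(2)]
    by (simp add: star_idem idem_mult dom_at_def)
  moreover have "e \<otimes>\<^bsub>S\<^esub> f \<otimes>\<^bsub>S\<^esub> e \<in> F \<longleftrightarrow> f \<in> F" if "f \<in> E" for f
    using pointed_filter_mult_iff[OF F] that e by simp
  ultimately show ?thesis
    by (auto intro: KS_pt_eqI)
qed

lemma dom_at_KS_act:
  assumes e: "e \<in> E"
  shows "{\<tau>. KS_act A e \<tau> = Some \<tau>} = KS_dom A e"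
proof (intro subset_antisym subsetI)
  fix \<tau> assume "\<tau> \<in> {\<tau>. KS_act A e \<tau> = Some \<tau>}"
  then have "\<tau> \<in> KS_dom A (star S e \<otimes>\<^bsub>S\<^esub> e)"
    by (simp add: KS_act_def Let_def split: if_splits)
  then show "\<tau> \<in> KS_dom A e"
    by (simp add: star_idem[OF e] idem_mult[OF e])
next
  fix \<tau> assume "\<tau> \<in> KS_dom A e"
  then show "\<tau> \<in> {\<tau>. KS_act A e \<tau> = Some \<tau>}"
    using KS_act_idem[OF _ e] by (elim KS_domE[OF _ e]) blast
qed

lemma KS_act_mult:
  assumes s: "s \<in> carrier S" and t: "t \<in> carrier S"
  shows "KS_act A (s \<otimes>\<^bsub>S\<^esub> t) = KS_act A s \<circ>\<^sub>m KS_act A t"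
proof
  fix \<tau>
  show "KS_act A (s \<otimes>\<^bsub>S\<^esub> t) \<tau> = (KS_act A s \<circ>\<^sub>m KS_act A t) \<tau>"
  proof (cases "\<tau> \<in> KS_points A")
    case True
    then obtain F x where F: "pointed_filter F x" and \<tau>: "\<tau> = KS_pt F x"
      by (rule KS_pointE)
    have conj: "star S (s \<otimes>\<^bsub>S\<^esub> t) \<otimes>\<^bsub>S\<^esub> e \<otimes>\<^bsub>S\<^esub> (s \<otimes>\<^bsub>S\<^esub> t) =
        star S t \<otimes>\<^bsub>S\<^esub> (star S s \<otimes>\<^bsub>S\<^esub> e \<otimes>\<^bsub>S\<^esub> s) \<otimes>\<^bsub>S\<^esub> t" if "e \<in> carrier S" for e
      using that s t by (simp add: star_mult assoc)
    have dom: "star S (s \<otimes>\<^bsub>S\<^esub> t) \<otimes>\<^bsub>S\<^esub> (s \<otimes>\<^bsub>S\<^esub> t) = star S t \<otimes>\<^bsub>S\<^esub> (star S s \<otimes>\<^bsub>S\<^esub> s) \<otimes>\<^bsub>S\<^esub> t"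
      using s t by (simp add: star_mult assoc)
    show ?thesis
    proof (cases "star S t \<otimes>\<^bsub>S\<^esub> t \<in> F")
      case tF: True
      define G where "G = {e \<in> E. star S t \<otimes>\<^bsub>S\<^esub> e \<otimes>\<^bsub>S\<^esub> t \<in> F}"
      obtain y where y: "\<theta> t x = Some y"
        using pointed_filter_dom_at[OF F tF] act_defined_iff[OF t] by blast
      have G: "pointed_filter G y"
        using pointed_filter_act[OF F t tF] y by (simp add: G_def)
      have "star S s \<otimes>\<^bsub>S\<^esub> s \<in> G \<longleftrightarrow> star S (s \<otimes>\<^bsub>S\<^esub> t) \<otimes>\<^bsub>S\<^esub> (s \<otimes>\<^bsub>S\<^esub> t) \<in> F"
        using s by (simp add: G_def dom)
      moreover have "{e \<in> E. star S s \<otimes>\<^bsub>S\<^esub> e \<otimes>\<^bsub>S\<^esub> s \<in> G} =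
          {e \<in> E. star S (s \<otimes>\<^bsub>S\<^esub> t) \<otimes>\<^bsub>S\<^esub> e \<otimes>\<^bsub>S\<^esub> (s \<otimes>\<^bsub>S\<^esub> t) \<in> F}"
        using s conj by (simp add: G_def cong: conj_cong)
      moreover have "\<theta> (s \<otimes>\<^bsub>S\<^esub> t) x = \<theta> s y"
        using s t y by (simp add: act_mult)
      ultimately have "KS_act A s (KS_pt G y) = KS_act A (s \<otimes>\<^bsub>S\<^esub> t) (KS_pt F x)"
        unfolding KS_act_pt[OF G s] KS_act_pt[OF F mult_closed[OF s t]] by simp
      moreover have "KS_act A t (KS_pt F x) = Some (KS_pt G y)"
        using KS_act_pt[OF F t] tF y by (simp add: G_def)
      ultimately show ?thesis
        by (simp add: \<tau>)
    next
      case False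
      then show ?thesis
        using pointed_filter_conj_imp[OF F t star_mult_idem[OF s]] KS_act_pt[OF F t]
          KS_act_pt[OF F mult_closed[OF s t]] by (auto simp: \<tau> dom)
    qed
  next
    case False
    then show ?thesis
      by (simp add: KS_act_outside)
  qed
qed

lemma KS_act_star:
  assumes s: "s \<in> carrier S" and \<tau>: "KS_act A s \<tau> = Some \<tau>'"
  shows "KS_act A (star S s) \<tau>' = Some \<tau>"
proof -
  have "\<tau> \<in> KS_dom A (star S s \<otimes>\<^bsub>S\<^esub> s)"
    using \<tau> by (simp add: KS_act_def Let_def split: if_splits)
  then have "KS_act A (star S s \<otimes>\<^bsub>S\<^esub> s) \<tau> = Some \<tau>"
    using dom_at_KS_act[OF star_mult_idem[OF s]] by blast
  then show ?thesis
    using s \<tau> by (simp add: KS_act_mult)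
qed

lemma KS_act_range:
  assumes s: "s \<in> carrier S" and \<tau>: "KS_act A s \<tau> = Some \<tau>'"
  shows "\<tau>' \<in> KS_dom A (s \<otimes>\<^bsub>S\<^esub> star S s)"
  using KS_act_star[OF s \<tau>] s by (simp add: KS_act_def star_star Let_def split: if_splits)

end


section \<open>The topology of \<open>X\<^sup>K\<^sup>S\<close>\<close>

text \<open>Coordinates at different indices take values in different spaces and can be compared only on
  open sets where one of them is finite. For this reason continuity is required only on an open subset.\<close>

lemma openin_disagreement:
  assumes W: "openin T W" and f: "continuous_map (subtopology T W) H f"
    and g: "continuous_map (subtopology T W) H g" and H: "Hausdorff_space H"
  shows "openin T {x \<in> W. f x \<noteq> g x}"
proof -
  have tW: "topspace (subtopology T W) = W"
    using openin_subset[OF W] by auto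
  have "{x \<in> W. f x \<noteq> g x} = topspace (subtopology T W) - {x \<in> topspace (subtopology T W). f x = g x}"
    unfolding tW by blast
  moreover have "openin (subtopology T W) \<dots>"
    by (rule openin_diff[OF openin_topspace closedin_continuous_maps_eq[OF H f g]])
  ultimately show ?thesis
    using W openin_trans_full by metis
qed

text \<open>Neighbourhoods of infinity are complements of compact closed sets, so compactness of the preimages
  is continuity at infinity.\<close>

lemma continuous_map_Alexandroff_map_option:
  assumes g: "continuous_map Y X g"
    and proper: "\<And>K. compactin X K \<Longrightarrow> compactin Y {y \<in> topspace Y. g y \<in> K}"
  shows "continuous_map (Alexandroff_compactification Y) (Alexandroff_compactification X) (map_option g)"
  unfolding continuous_map_def
proof (intro conjI allI impI)
  show "map_option g \<in> topspace (Alexandroff_compactification Y) \<rightarrow> topspace (Alexandroff_compactification X)"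
    using continuous_map_funspace[OF g] by auto
  fix V assume "openin (Alexandroff_compactification X) V"
  then consider U where "openin X U" "V = Some ` U"
    | K where "compactin X K" "closedin X K" "V = insert None (Some ` (topspace X - K))"
    unfolding openin_Alexandroff_compactification by blast
  then show "openin (Alexandroff_compactification Y)
      {y \<in> topspace (Alexandroff_compactification Y). map_option g y \<in> V}"
  proof cases
    case 1
    have "{y \<in> topspace (Alexandroff_compactification Y). map_option g y \<in> V}
        = Some ` {y \<in> topspace Y. g y \<in> U}"
      unfolding 1(2) by auto
    then show ?thesis
      using openin_continuous_map_preimage[OF g 1(1)] by simp
  next
    case 2
    have "{y \<in> topspace (Alexandroff_compactification Y). map_option g y \<in> V}
        = insert None (Some ` (topspace Y - {y \<in> topspace Y. g y \<in> K}))"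
      unfolding 2(3) using continuous_map_funspace[OF g] by auto
    then show ?thesis
      using proper[OF 2(1)] closedin_continuous_map_preimage[OF g 2(2)]
      unfolding openin_Alexandroff_compactification by blast
  qed
qed

locale lch_action = isg_action A for A :: "('s, 'x) isaction" +
  assumes lc: "locally_compact_space X" and Hausdorff: "Hausdorff_space X"
begin

abbreviation "P \<equiv> KS_prod A"
abbreviation "AC e \<equiv> Alexandroff_compactification (subtopology X (D e))"

lemma Hausdorff_AC: "e \<in> E \<Longrightarrow> Hausdorff_space (AC e)"
  unfolding Hausdorff_space_Alexandroff_compactification
  using Hausdorff_space_subtopology[OF Hausdorff]
    locally_compact_space_open_subset[OF _ lc openin_dom_at] Hausdorff by blast

lemma compact_KS_prod: "compact_space P"
  unfolding KS_prod_def compact_space_product_topology by simp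

lemma Hausdorff_KS_prod: "Hausdorff_space P"
  unfolding KS_prod_def Hausdorff_space_product_topology using Hausdorff_AC by blast

lemma continuous_map_coord: "e \<in> E \<Longrightarrow> continuous_map P (AC e) (\<lambda>\<tau>. \<tau> e)"
  unfolding KS_prod_def by (rule continuous_map_product_projection)

definition cylinder :: "'s \<Rightarrow> 'x set \<Rightarrow> ('s \<Rightarrow> 'x option) set" where
  "cylinder e U = {\<tau> \<in> topspace P. \<tau> e \<in> Some ` U}"

lemma openin_cylinder:
  assumes "e \<in> E" "openin X U" "U \<subseteq> D e"
  shows "openin P (cylinder e U)"
proof -
  have "openin (subtopology X (D e)) U"
    using assms(2,3) openin_open_subtopology[OF openin_dom_at[OF assms(1)]] by blast
  then show ?thesis
    unfolding cylinder_def by (intro openin_continuous_map_preimage[OF continuous_map_coord[OF assms(1)]]) simp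
qed

lemma continuous_map_base_point:
  assumes e: "e \<in> E" and U: "openin X U" "U \<subseteq> D e"
  shows "continuous_map (subtopology P (cylinder e U)) (subtopology X U) (\<lambda>\<tau>. the (\<tau> e))"
proof (rule continuous_map_into_subtopology)
  have t: "topspace (subtopology P (cylinder e U)) = cylinder e U"
    using openin_subset[OF openin_cylinder[OF assms]] by auto
  show "(\<lambda>\<tau>. the (\<tau> e)) \<in> topspace (subtopology P (cylinder e U)) \<rightarrow> U"
    unfolding t by (auto simp: cylinder_def)
  show "continuous_map (subtopology P (cylinder e U)) X (\<lambda>\<tau>. the (\<tau> e))"
    unfolding continuous_map_def t
  proof (intro conjI allI impI)
    show "(\<lambda>\<tau>. the (\<tau> e)) \<in> cylinder e U \<rightarrow> topspace X"
      using openin_subset[OF U(1)] by (auto simp: cylinder_def)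
    fix V assume V: "openin X V"
    have "{\<tau> \<in> cylinder e U. the (\<tau> e) \<in> V} = cylinder e (U \<inter> V)"
      by (auto simp: cylinder_def)
    moreover have "openin P (cylinder e (U \<inter> V))"
      using openin_cylinder[OF e openin_Int[OF U(1) V]] U(2) by blast
    moreover have "cylinder e (U \<inter> V) \<subseteq> cylinder e U"
      by (auto simp: cylinder_def)
    ultimately show "openin (subtopology P (cylinder e U)) {\<tau> \<in> cylinder e U. the (\<tau> e) \<in> V}"
      using openin_open_subtopology[OF openin_cylinder[OF assms]] by simp
  qed
qed

text \<open>The inclusion \<open>X\<^sub>e \<inter> X\<^sub>f \<rightarrow> X\<^sub>f\<close> need not extend continuously to infinity, so the coordinate at
  \<open>e\<close> is read in the compactification of \<open>X\<^sub>f\<close> only where it is finite and lies in the intersection.\<close>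

lemma continuous_map_coord_into:
  assumes e: "e \<in> E" and f: "f \<in> E" and U: "openin X U" "U \<subseteq> D e" "U \<subseteq> D f"
  shows "continuous_map (subtopology P (cylinder e U)) (AC f) (\<lambda>\<tau>. \<tau> e)"
proof -
  have "continuous_map (subtopology X U) (subtopology X (D f)) id"
    using U(3) by (intro continuous_map_into_subtopology[OF continuous_map_id_subt]) auto
  then have "continuous_map (subtopology X U) (AC f) (Some \<circ> id)"
    using continuous_map_Some by (rule continuous_map_compose)
  with continuous_map_base_point[OF e U(1,2)]
  have "continuous_map (subtopology P (cylinder e U)) (AC f) ((Some \<circ> id) \<circ> (\<lambda>\<tau>. the (\<tau> e)))"
    by (rule continuous_map_compose)
  then show ?thesis
    by (rule continuous_map_eq) (auto simp: cylinder_def)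
qed

lemma openin_cylinder_disagreement:
  assumes "e \<in> E" "f \<in> E" "openin X U" "U \<subseteq> D e" "U \<subseteq> D f"
  shows "openin P {\<tau> \<in> cylinder e U. \<tau> e \<noteq> \<tau> f}"
  using openin_cylinder[OF assms(1,3,4)] continuous_map_coord_into[OF assms]
    continuous_map_from_subtopology[OF continuous_map_coord[OF assms(2)]] Hausdorff_AC[OF assms(2)]
  by (rule openin_disagreement)

lemma KS_tildeE:
  assumes "\<tau> \<in> KS_tilde A" "e \<in> E" "\<tau> e \<noteq> None"
  obtains F x where "pointed_filter F x" "e \<in> F" "\<tau> = KS_pt F x"
proof -
  have "\<tau> \<noteq> KS_infty A"
    using assms(2,3) by (auto simp: KS_infty_def)
  then have "\<tau> \<in> KS_dom A e"
    using assms by (simp add: KS_dom_def KS_points_def)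
  then show thesis
    using assms(2) that by (rule KS_domE)
qed

text \<open>The requirement that the coordinate at \<open>e\<^sub>1 e\<^sub>2\<close> is finite if those at \<open>e\<^sub>1\<close> and \<open>e\<^sub>2\<close> are
  need not be closed by itself: finite coordinates at \<open>e\<^sub>1 e\<^sub>2\<close> can tend to infinity. Together with
  the compatibility of coordinates along the order it is. In a convergent net of points the three
  coordinates agree, and then so do the finite limits at \<open>e\<^sub>1\<close> and \<open>e\<^sub>2\<close>, as \<open>X\<close> is Hausdorff; the
  common limit lies in \<open>X\<^bsub>e\<^sub>1\<^esub> \<inter> X\<^bsub>e\<^sub>2\<^esub> = X\<^bsub>e\<^sub>1e\<^sub>2\<^esub>\<close>, so the limit at \<open>e\<^sub>1 e\<^sub>2\<close> is finite.\<close>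

lemma closedin_KS_tilde: "closedin P (KS_tilde A)"
  unfolding closedin_def
proof
  show "KS_tilde A \<subseteq> topspace P"
    by (auto simp: KS_tilde_def)
  show "openin P (topspace P - KS_tilde A)"
  proof (subst openin_subopen, intro ballI)
    fix \<tau> assume \<tau>: "\<tau> \<in> topspace P - KS_tilde A"
    then have val: "e \<in> E \<Longrightarrow> \<tau> e \<in> insert None (Some ` D e)" for e
      by (auto simp: topspace_KS_prod)
    consider (up) e1 e2 where "e1 \<in> E" "e2 \<in> E" "e1 \<otimes>\<^bsub>S\<^esub> e2 = e1" "\<tau> e1 \<noteq> None" "\<tau> e1 \<noteq> \<tau> e2"
      | (meet) e1 e2 where "e1 \<in> E" "e2 \<in> E" "\<tau> e1 \<noteq> None" "\<tau> e2 \<noteq> None" "\<tau> (e1 \<otimes>\<^bsub>S\<^esub> e2) = None"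
      using \<tau> nat_le_idem_iff unfolding KS_tilde_def by force
    then show "\<exists>T. openin P T \<and> \<tau> \<in> T \<and> T \<subseteq> topspace P - KS_tilde A"
    proof cases
      case up
      let ?T = "{\<sigma> \<in> cylinder e1 (D e1). \<sigma> e1 \<noteq> \<sigma> e2}"
      have "D e1 \<subseteq> D e2"
        using dom_at_mult[OF up(1,2)] up(3) by auto
      then have "openin P ?T"
        using openin_cylinder_disagreement[OF up(1,2) openin_dom_at[OF up(1)]] by blast
      moreover have "\<tau> \<in> ?T"
        using \<tau> up val[OF up(1)] by (auto simp: cylinder_def)
      moreover have "\<sigma> \<notin> KS_tilde A" if \<sigma>: "\<sigma> \<in> ?T" for \<sigma>
      proof
        assume "\<sigma> \<in> KS_tilde A"
        moreover have "\<sigma> e1 \<noteq> None" using \<sigma> by (auto simp: cylinder_def)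
        ultimately obtain F x where F: "pointed_filter F x" "e1 \<in> F" "\<sigma> = KS_pt F x"
          using up(1) by (elim KS_tildeE)
        then have "e2 \<in> F"
          using pointed_filter_mult_iff[OF F(1) up(1,2)] up(3) by simp
        then show False
          using \<sigma> F up(1,2) by (simp add: KS_pt_apply)
      qed
      ultimately show ?thesis
        by (intro exI[of _ ?T]) (auto simp: cylinder_def)
    next
      case meet
      let ?e = "e1 \<otimes>\<^bsub>S\<^esub> e2"
      obtain x y where xy: "\<tau> e1 = Some x" "\<tau> e2 = Some y" "x \<in> D e1" "y \<in> D e2"
        using meet val[OF meet(1)] val[OF meet(2)] by auto
      have point: "\<sigma> e1 = \<sigma> e2 \<and> \<sigma> ?e = \<sigma> e1"
        if \<sigma>: "\<sigma> \<in> KS_tilde A" "\<sigma> e1 \<noteq> None" "\<sigma> e2 \<noteq> None" for \<sigma>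
      proof -
        obtain F z where F: "pointed_filter F z" "e1 \<in> F" "\<sigma> = KS_pt F z"
          using \<sigma>(1) meet(1) \<sigma>(2) by (rule KS_tildeE)
        then have "e2 \<in> F"
          using \<sigma>(3) meet(2) by (simp add: KS_pt_apply split: if_splits)
        then show ?thesis
          using F meet(1,2) pointed_filter_mult_iff[OF F(1) meet(1,2)] by (simp add: KS_pt_apply)
      qed
      show ?thesis
      proof (cases "x = y")
        case True
        \<comment> \<open>The common value lies in \<open>D e1 \<inter> D e2\<close>, which is the open set \<open>D ?e\<close>, and as long as the coordinate at \<open>e1\<close>
          stays there it can be compared with the one at \<open>?e\<close>.\<close>
        let ?T = "{\<sigma> \<in> cylinder e1 (D ?e). \<sigma> e1 \<noteq> \<sigma> ?e} \<inter> cylinder e2 (D e2)"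
        have D: "D ?e = D e1 \<inter> D e2"
          by (rule dom_at_mult[OF meet(1,2)])
        have "openin P ?T"
          using openin_cylinder_disagreement[OF meet(1) _ openin_dom_at, of ?e ?e] meet(1,2) D
          by (intro openin_Int openin_cylinder openin_dom_at) auto
        moreover have "\<tau> \<in> ?T"
          using \<tau> xy meet True by (auto simp: cylinder_def D)
        moreover have "\<sigma> \<notin> KS_tilde A" if "\<sigma> \<in> ?T" for \<sigma>
          using that point[of \<sigma>] by (auto simp: cylinder_def)
        ultimately show ?thesis
          by (intro exI[of _ ?T]) (auto simp: cylinder_def)
      next
        case False
        have "x \<in> topspace X" "y \<in> topspace X"
          using xy dom_at_subset meet(1,2) by blast+
        then obtain U V where UV: "openin X U" "openin X V" "x \<in> U" "y \<in> V" "disjnt U V"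
          using Hausdorff False unfolding Hausdorff_space_def by metis
        let ?T = "cylinder e1 (D e1 \<inter> U) \<inter> cylinder e2 (D e2 \<inter> V)"
        have "openin P ?T"
          using meet(1,2) UV by (intro openin_Int openin_cylinder openin_dom_at) auto
        moreover have "\<tau> \<in> ?T"
          using \<tau> xy UV by (auto simp: cylinder_def)
        moreover have "\<sigma> \<notin> KS_tilde A" if "\<sigma> \<in> ?T" for \<sigma>
          using that point[of \<sigma>] UV(5) by (auto simp: cylinder_def disjnt_iff)
        ultimately show ?thesis
          by (intro exI[of _ ?T]) (auto simp: cylinder_def)
      qed
    qed
  qed
qed

lemma topspace_KS: "topspace (subtopology P (KS_points A)) = KS_points A"
  by (auto simp: KS_points_def KS_tilde_def)

lemma Hausdorff_KS: "Hausdorff_space (subtopology P (KS_points A))"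
  by (rule Hausdorff_space_subtopology[OF Hausdorff_KS_prod])

lemma locally_compact_KS: "locally_compact_space (subtopology P (KS_points A))"
proof -
  let ?T = "subtopology P (KS_tilde A)"
  have "compact_space ?T"
    using closedin_compact_space[OF compact_KS_prod closedin_KS_tilde] by (rule compact_space_subtopology)
  moreover have H: "Hausdorff_space ?T"
    by (rule Hausdorff_space_subtopology[OF Hausdorff_KS_prod])
  moreover have t: "topspace ?T = KS_tilde A"
    using closedin_subset[OF closedin_KS_tilde] by auto
  moreover have "closedin ?T {KS_infty A}"
    using H KS_infty_in_tilde by (intro closedin_Hausdorff_singleton) (simp_all only: t)
  then have "openin ?T (KS_points A)"
    unfolding KS_points_def
    using openin_diff[OF openin_topspace, of ?T "{KS_infty A}", unfolded t] by blast
  ultimately have "locally_compact_space (subtopology ?T (KS_points A))"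
    using locally_compact_space_open_subset[of ?T "KS_points A"] compact_imp_locally_compact_space
    by blast
  moreover have "KS_tilde A \<inter> KS_points A = KS_points A"
    by (auto simp: KS_points_def)
  ultimately show ?thesis
    by (simp add: subtopology_subtopology)
qed

lemma KS_dom_eq:
  assumes e: "e \<in> E"
  shows "KS_dom A e = KS_points A \<inter> cylinder e (D e)"
proof -
  have "\<tau> \<in> cylinder e (D e) \<longleftrightarrow> \<tau> e \<noteq> None" if "\<tau> \<in> KS_points A" for \<tau>
  proof -
    have P: "\<tau> \<in> topspace P"
      using that unfolding KS_points_def KS_tilde_def by blast
    then have "\<tau> e \<in> insert None (Some ` D e)"
      using e unfolding topspace_KS_prod by (rule PiE_mem)
    then show ?thesis
      using P unfolding cylinder_def by auto
  qed
  then show ?thesis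
    unfolding KS_dom_def by blast
qed

lemma openin_KS_dom: "e \<in> E \<Longrightarrow> openin (subtopology P (KS_points A)) (KS_dom A e)"
  unfolding KS_dom_eq using openin_cylinder[OF _ openin_dom_at, of e e]
  by (simp add: openin_subtopology_Int2)

lemma KS_dom_subset: "KS_dom A e \<subseteq> KS_points A"
  by (auto simp: KS_dom_def)

end


section \<open>The action on \<open>X\<^sup>K\<^sup>S\<close> as an object of the category\<close>

context lch_action
begin

lemma openin_act_preimage:
  assumes s: "s \<in> carrier S" and V: "openin X V"
  shows "openin X {x \<in> D (star S s \<otimes>\<^bsub>S\<^esub> s). the (\<theta> s x) \<in> V}"
proof -
  let ?D = "D (star S s \<otimes>\<^bsub>S\<^esub> s)"
  have o: "openin X ?D"
    using s by (intro openin_dom_at) simp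
  then have t: "topspace (subtopology X ?D) = ?D"
    using openin_subset by fastforce
  have "continuous_map (subtopology X ?D) X (\<lambda>x. the (\<theta> s x))"
    using continuous_map_act[OF s] continuous_map_in_subtopology by blast
  from openin_continuous_map_preimage[OF this V] show ?thesis
    unfolding t using o by (rule openin_trans_full)
qed

text \<open>A coordinate of \<open>\<theta>\<^sup>K\<^sup>S\<^sub>s\<close> need not be the extension of a proper map, since \<open>\<theta>\<^bsub>es\<^esub>\<close> maps onto
  \<open>X\<^bsub>ess\<^sup>*\<^esub>\<close>, which is only an open subset of \<open>X\<^sub>e\<close>. Continuity at infinity comes from
  the base point instead, which is finite at the index \<open>s\<^sup>* s\<close>: the image stays away from a
  compact \<open>K \<subseteq> X\<^sub>e\<close> if either the base point is moved outside \<open>K\<close>, or it lies in the domain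
  \<open>X\<^bsub>s\<^sup>*es\<^esub>\<close> but \<open>s\<^sup>* e s\<close> is not in the filter. Both alternatives are open conditions, the second one
  as a disagreement of coordinates.\<close>

lemma continuous_map_KS_act_coord:
  assumes s: "s \<in> carrier S" and e: "e \<in> E"
  shows "continuous_map (subtopology P (KS_dom A (star S s \<otimes>\<^bsub>S\<^esub> s))) (AC e)
    (\<lambda>\<tau>. the (KS_act A s \<tau>) e)"
proof -
  let ?g = "star S s \<otimes>\<^bsub>S\<^esub> s" and ?c = "star S s \<otimes>\<^bsub>S\<^esub> e \<otimes>\<^bsub>S\<^esub> s"
  let ?Z = "subtopology P (KS_dom A ?g)"
  have gE: "?g \<in> E" and cE: "?c \<in> E"
    using s e by simp_all
  have val: "the (KS_act A s (KS_pt F x)) e = (if ?c \<in> F then Some (the (\<theta> s x)) else None)"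
    if "pointed_filter F x" "?g \<in> F" for F x
    using KS_act_pt[OF that(1) s] that(2) e by (simp add: KS_pt_apply)
  have img: "the (\<theta> s x) \<in> D e \<longleftrightarrow> x \<in> D ?c" if "x \<in> D ?g" for x
    using that act_defined_iff[OF s, of x] act_in_dom_at_iff[OF s e, of x] by auto
  have imgX: "the (\<theta> s x) \<in> topspace X" if x: "x \<in> D ?g" for x
  proof -
    obtain y where y: "\<theta> s x = Some y"
      using act_defined_iff[OF s, of x] x by blast
    then have "y \<in> topspace X"
      using act_in_range[OF s y] dom_at_subset[OF mult_star_idem[OF s]] by blast
    then show ?thesis by (simp add: y)
  qed
  have DcDg: "D ?c \<subseteq> D ?g"
    using dom_at_mult[OF cE gE] conj_le[OF s e] by auto
  have tZ: "topspace ?Z = KS_dom A ?g"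
    using KS_dom_subset[of ?g] topspace_KS by auto
  have PZ: "KS_dom A ?g \<subseteq> topspace P"
    using KS_dom_subset[of ?g] topspace_KS by auto
  have fin: "KS_pt F x \<in> cylinder f U \<longleftrightarrow> f \<in> F \<and> x \<in> U"
    if "KS_pt F x \<in> KS_dom A ?g" "f \<in> E" for F x f U
    using that PZ by (auto simp: cylinder_def KS_pt_apply split: if_splits)
  show ?thesis
    unfolding continuous_map_def tZ
  proof (intro conjI allI impI)
    have range: "the (KS_act A s \<tau>) e \<in> topspace (AC e)" if \<tau>: "\<tau> \<in> KS_dom A ?g" for \<tau>
    proof -
      obtain F x where F: "pointed_filter F x" "?g \<in> F" "\<tau> = KS_pt F x"
        using \<tau> gE by (rule KS_domE)
      have "the (\<theta> s x) \<in> D e" if "?c \<in> F"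
        using img[OF pointed_filter_dom_at[OF F(1,2)]] pointed_filter_dom_at[OF F(1) that] by simp
      then show ?thesis
        using val[OF F(1,2)] dom_at_subset[OF e] by (auto simp: F(3))
    qed
    then show "(\<lambda>\<tau>. the (KS_act A s \<tau>) e) \<in> KS_dom A ?g \<rightarrow> topspace (AC e)"
      by blast
    fix V assume V: "openin (AC e) V"
    let ?W = "{\<tau> \<in> KS_dom A ?g. the (KS_act A s \<tau>) e \<in> V}"
    have open_sub: "openin ?Z ?W" if "openin P Q" "\<And>\<tau>. \<tau> \<in> KS_dom A ?g \<Longrightarrow> the (KS_act A s \<tau>) e \<in> V \<longleftrightarrow> \<tau> \<in> Q" for Q
    proof -
      have "?W = Q \<inter> KS_dom A ?g" using that(2) by blast
      then show ?thesis using that(1) by (auto simp: openin_subtopology)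
    qed
    from V consider U where "openin (subtopology X (D e)) U" "V = Some ` U"
      | K where "compactin (subtopology X (D e)) K"
          "V = insert None (Some ` (topspace (subtopology X (D e)) - K))"
      unfolding openin_Alexandroff_compactification by blast
    then show "openin ?Z ?W"
    proof cases
      case 1
      then have U: "openin X U" "U \<subseteq> D e"
        using openin_open_subtopology[OF openin_dom_at[OF e]] by blast+
      let ?U = "{x \<in> D ?g. the (\<theta> s x) \<in> U}"
      have Uc: "?U \<subseteq> D ?c"
        using img U(2) by blast
      show ?thesis
      proof (rule open_sub)
        show "openin P (cylinder ?c ?U)"
          using openin_cylinder[OF cE openin_act_preimage[OF s U(1)] Uc] .
        fix \<tau> assume \<tau>: "\<tau> \<in> KS_dom A ?g"
        then obtain F x where F: "pointed_filter F x" "?g \<in> F" "\<tau> = KS_pt F x"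
          using gE by (rule KS_domE)
        show "the (KS_act A s \<tau>) e \<in> V \<longleftrightarrow> \<tau> \<in> cylinder ?c ?U"
          using val[OF F(1,2)] fin[OF _ cE, of F x ?U] \<tau> pointed_filter_dom_at[OF F(1,2)]
          by (auto simp: F(3) 1(2))
      qed
    next
      case 2
      then have K: "compactin X K" "K \<subseteq> D e"
        by (auto simp: compactin_subtopology)
      then have oK: "openin X (topspace X - K)"
        using compactin_imp_closedin[OF Hausdorff K(1)] by blast
      let ?U = "{x \<in> D ?g. the (\<theta> s x) \<in> topspace X - K}"
      let ?R = "{\<tau> \<in> cylinder ?g (D ?c). \<tau> ?g \<noteq> \<tau> ?c}"
      show ?thesis
      proof (rule open_sub)
        show "openin P (cylinder ?g ?U \<union> ?R)"
          using openin_cylinder[OF gE openin_act_preimage[OF s oK]]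
            openin_cylinder_disagreement[OF gE cE openin_dom_at[OF cE] DcDg] by blast
        fix \<tau> assume \<tau>: "\<tau> \<in> KS_dom A ?g"
        then obtain F x where F: "pointed_filter F x" "?g \<in> F" "\<tau> = KS_pt F x"
          using gE by (rule KS_domE)
        have x: "x \<in> D ?g"
          by (rule pointed_filter_dom_at[OF F(1,2)])
        have "the (KS_act A s \<tau>) e \<in> V \<longleftrightarrow> ?c \<notin> F \<or> the (\<theta> s x) \<in> D e - K"
          using val[OF F(1,2)] imgX[OF x] by (auto simp: F(3) 2(2))
        also have "\<dots> \<longleftrightarrow> the (\<theta> s x) \<in> topspace X - K \<or> (x \<in> D ?c \<and> ?c \<notin> F)"
          using img[OF x] imgX[OF x] K(2) pointed_filter_dom_at[OF F(1), of ?c] by blast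
        also have "\<dots> \<longleftrightarrow> \<tau> \<in> cylinder ?g ?U \<union> ?R"
          using fin[OF _ gE, of F x ?U] fin[OF _ gE, of F x "D ?c"] \<tau> F(2) x gE cE
          by (auto simp: F(3) KS_pt_apply)
        finally show "the (KS_act A s \<tau>) e \<in> V \<longleftrightarrow> \<tau> \<in> cylinder ?g ?U \<union> ?R" .
      qed
    qed
  qed
qed

lemma continuous_map_KS_act:
  assumes s: "s \<in> carrier S"
  shows "continuous_map (subtopology (subtopology P (KS_points A)) (KS_dom A (star S s \<otimes>\<^bsub>S\<^esub> s)))
    (subtopology (subtopology P (KS_points A)) (KS_dom A (s \<otimes>\<^bsub>S\<^esub> star S s)))
    (\<lambda>\<tau>. the (KS_act A s \<tau>))"
proof -
  let ?g = "star S s \<otimes>\<^bsub>S\<^esub> s"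
  have sub: "subtopology (subtopology P (KS_points A)) (KS_dom A f) = subtopology P (KS_dom A f)" for f
    using KS_dom_subset[of f] by (simp add: subtopology_subtopology inf.absorb2)
  have t: "topspace (subtopology P (KS_dom A ?g)) = KS_dom A ?g"
    using KS_dom_subset[of ?g] topspace_KS by auto
  have range: "the (KS_act A s \<tau>) \<in> KS_dom A (s \<otimes>\<^bsub>S\<^esub> star S s)" if "\<tau> \<in> KS_dom A ?g" for \<tau>
  proof -
    have "KS_act A s \<tau> \<noteq> None"
      using that by (simp add: KS_act_def Let_def)
    then show ?thesis
      using KS_act_range[OF s] by force
  qed
  have "KS_dom A f \<subseteq> extensional E" for f
    using KS_dom_subset[of f] topspace_KS by (auto simp: topspace_KS_prod PiE_def)
  then have "continuous_map (subtopology P (KS_dom A ?g)) P (\<lambda>\<tau>. the (KS_act A s \<tau>))"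
    using range continuous_map_KS_act_coord[OF s] t
    unfolding KS_prod_def[of A] continuous_map_componentwise by fastforce
  then show ?thesis
    unfolding sub using range t by (intro continuous_map_into_subtopology) auto
qed

lemma KS_partial_bijection:
  assumes s: "s \<in> carrier S"
  shows "partial_bijection (KS_points A) (KS_act A s)"
  unfolding partial_bijection_def
proof (intro conjI)
  show "dom (KS_act A s) \<subseteq> KS_points A"
    using KS_act_outside by fastforce
  show "ran (KS_act A s) \<subseteq> KS_points A"
    using KS_act_range[OF s] KS_dom_subset by (fastforce simp: ran_def)
  show "inj_on (KS_act A s) (dom (KS_act A s))"
  proof (rule inj_onI)
    fix \<sigma> \<tau> assume "\<sigma> \<in> dom (KS_act A s)" "KS_act A s \<sigma> = KS_act A s \<tau>"
    then obtain \<rho> where "KS_act A s \<sigma> = Some \<rho>" "KS_act A s \<tau> = Some \<rho>"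
      by (metis domD)
    then show "\<sigma> = \<tau>"
      using KS_act_star[OF s, of \<sigma>] KS_act_star[OF s, of \<tau>] by simp
  qed
qed

lemma dom_at_KS_obj: "e \<in> E \<Longrightarrow> dom_at (KS_obj A) e = KS_dom A e"
  using dom_at_KS_act by (simp add: dom_at_def KS_obj_def)

lemma is_action_KS_obj: "is_action (KS_obj A)"
proof -
  have S: "semig (KS_obj A) = S" and X: "tspace (KS_obj A) = subtopology P (KS_points A)"
    and \<theta>: "act (KS_obj A) = KS_act A"
    by (simp_all add: KS_obj_def)
  have "(\<Union>e\<in>E. KS_dom A e) = KS_points A"
  proof
    show "(\<Union>e\<in>E. KS_dom A e) \<subseteq> KS_points A"
      using KS_dom_subset by blast
    show "KS_points A \<subseteq> (\<Union>e\<in>E. KS_dom A e)"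
    proof
      fix \<tau> assume "\<tau> \<in> KS_points A"
      then obtain F x where F: "pointed_filter F x" "\<tau> = KS_pt F x"
        by (rule KS_pointE)
      then show "\<tau> \<in> (\<Union>e\<in>E. KS_dom A e)"
        using pointed_filter_nonempty[OF F(1)] KS_pt_in_dom_iff[OF F(1)] by blast
    qed
  qed
  then have U: "(\<Union>e\<in>E. dom_at (KS_obj A) e) = KS_points A"
    by (simp add: dom_at_KS_obj)
  show ?thesis
    unfolding is_action_def Let_def S X \<theta> topspace_KS U
    using inverse_semigroup KS_partial_bijection KS_act_mult openin_KS_dom continuous_map_KS_act
    by (simp add: dom_at_KS_obj)
qed

lemma KS_obj_in_ISA_pr_obj: "KS_obj A \<in> ISA_pr_obj"
  unfolding ISA_pr_obj_def
  using is_action_KS_obj locally_compact_KS Hausdorff_KS by (simp add: KS_obj_def)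

end

lemma lch_action_if_ISA_pr_obj: "A \<in> ISA_pr_obj \<Longrightarrow> lch_action A"
  by (simp add: ISA_pr_obj_def lch_action_def isg_action_def lch_action_axioms_def)


section \<open>The map \<open>f\<^sup>K\<^sup>S\<close> of a proper action morphism\<close>

locale proper_action_morphism =
  A: lch_action A + B: lch_action B
  for A :: "('s, 'x) isaction" and B :: "('t, 'y) isaction" +
  fixes \<phi> :: "'s \<Rightarrow> 't" and f :: "'y \<rightharpoonup> 'x"
  assumes morphism: "(\<phi>, f) \<in> ISA_pr_hom A B"
begin

abbreviation "pull F \<equiv> {e \<in> A.E. \<phi> e \<in> F}"

lemma hom: "\<phi> \<in> semigroup_hom A.S B.S"
  and partial: "partial_map B.X A.X f"
  and preim_dom_at: "e \<in> A.E \<Longrightarrow> preim f (A.D e) = B.D (\<phi> e)"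
  and act_commute: "s \<in> carrier A.S \<Longrightarrow> y \<in> preim f (A.D (star A.S s \<otimes>\<^bsub>A.S\<^esub> s)) \<Longrightarrow>
    (A.\<theta> s \<circ>\<^sub>m f) y = (f \<circ>\<^sub>m B.\<theta> (\<phi> s)) y"
  and proper: "proper_partial_map B.X A.X f"
  using morphism unfolding ISA_pr_hom_def action_morphisms_def mem_Collect_eq case_prod_conv
  by blast+

lemma hom_closed [simp]: "s \<in> carrier A.S \<Longrightarrow> \<phi> s \<in> carrier B.S"
  and hom_mult: "s \<in> carrier A.S \<Longrightarrow> t \<in> carrier A.S \<Longrightarrow> \<phi> (s \<otimes>\<^bsub>A.S\<^esub> t) = \<phi> s \<otimes>\<^bsub>B.S\<^esub> \<phi> t"
  using hom by (auto simp: semigroup_hom_def)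

lemma hom_idem [simp]: "e \<in> A.E \<Longrightarrow> \<phi> e \<in> B.E"
  using hom_mult[of e e] by (intro B.idemI) (simp_all add: A.idem_mult)

lemma hom_conj:
  "s \<in> carrier A.S \<Longrightarrow> e \<in> A.E \<Longrightarrow>
    \<phi> (star A.S s \<otimes>\<^bsub>A.S\<^esub> e \<otimes>\<^bsub>A.S\<^esub> s) = star B.S (\<phi> s) \<otimes>\<^bsub>B.S\<^esub> \<phi> e \<otimes>\<^bsub>B.S\<^esub> \<phi> s"
  and hom_star_mult:
  "s \<in> carrier A.S \<Longrightarrow> \<phi> (star A.S s \<otimes>\<^bsub>A.S\<^esub> s) = star B.S (\<phi> s) \<otimes>\<^bsub>B.S\<^esub> \<phi> s"
  by (simp_all add: hom_mult hom_star[OF A.inverse_semigroup B.inverse_semigroup hom])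

lemma map_in_dom_at_iff:
  assumes "e \<in> A.E" "f y = Some x"
  shows "y \<in> B.D (\<phi> e) \<longleftrightarrow> x \<in> A.D e"
  unfolding preim_dom_at[OF assms(1), symmetric] preim_def using assms(2) by auto

lemma map_in_dom_at:
  assumes e: "e \<in> A.E" and y: "y \<in> B.D (\<phi> e)"
  obtains x where "f y = Some x" "x \<in> A.D e"
proof -
  have "y \<in> dom f"
    using y unfolding preim_dom_at[OF e, symmetric] preim_def by blast
  then obtain x where x: "f y = Some x" by blast
  then show thesis
    using that y map_in_dom_at_iff[OF e] by blast
qed

lemma KS_map_tilde_pt:
  assumes F: "B.pointed_filter F y"
  shows "KS_map_tilde A \<phi> f (B.KS_pt F y) = A.KS_pt (pull F) (the (f y))"
  unfolding KS_map_tilde_def A.KS_pt_def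
proof (rule restrict_ext)
  fix e assume e: "e \<in> A.E"
  have "f y = Some (the (f y))" if "\<phi> e \<in> F"
    using B.pointed_filter_dom_at[OF F that] e by (elim map_in_dom_at[rotated]) simp_all
  then show "(case B.KS_pt F y (\<phi> e) of None \<Rightarrow> None | Some y \<Rightarrow> f y) =
      (if e \<in> pull F then Some (the (f y)) else None)"
    using e by (simp add: B.KS_pt_apply)
qed

lemma pointed_filter_pull:
  assumes F: "B.pointed_filter F y" and e: "e \<in> A.E" "\<phi> e \<in> F"
  shows "A.pointed_filter (pull F) (the (f y))"
proof -
  have "the (f y) \<in> A.D g" if "g \<in> A.E" "\<phi> g \<in> F" for g
    using B.pointed_filter_dom_at[OF F that(2)] that(1) by (elim map_in_dom_at[rotated]) simp_all
  moreover have "g \<otimes>\<^bsub>A.S\<^esub> h \<in> pull F \<longleftrightarrow> g \<in> pull F \<and> h \<in> pull F" if "g \<in> A.E" "h \<in> A.E" for g h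
    using that B.pointed_filter_mult_iff[OF F, of "\<phi> g" "\<phi> h"] by (simp add: hom_mult)
  ultimately show ?thesis
    using e unfolding A.pointed_filter_def A.idem_filter_def by blast
qed

lemma KS_map_tilde_infty: "KS_map_tilde A \<phi> f (KS_infty B) = KS_infty A"
  unfolding KS_map_tilde_def KS_infty_def by (rule restrict_ext) simp

lemma KS_pt_pull_empty: "(\<And>e. e \<in> A.E \<Longrightarrow> \<phi> e \<notin> F) \<Longrightarrow> A.KS_pt (pull F) x = KS_infty A"
  unfolding KS_infty_def A.KS_pt_def by (rule restrict_ext) simp

lemma KS_map_outside: "\<omega> \<notin> KS_points B \<Longrightarrow> KS_map A B \<phi> f \<omega> = None"
  using KS_map_tilde_infty by (auto simp: KS_map_def KS_points_def)

text \<open>When no \<open>\<phi> e\<close> belongs to the filter, every coordinate of the image is infinite. The image is then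
  \<open>\<infinity>\<close>, which is not a point of \<open>X\<^sup>K\<^sup>S\<close>.\<close>

lemma KS_map_pt:
  assumes F: "B.pointed_filter F y"
  shows "KS_map A B \<phi> f (B.KS_pt F y) =
    (if \<exists>e\<in>A.E. \<phi> e \<in> F then Some (A.KS_pt (pull F) (the (f y))) else None)"
proof (cases "\<exists>e\<in>A.E. \<phi> e \<in> F")
  case True
  then have "A.KS_pt (pull F) (the (f y)) \<in> KS_points A"
    using pointed_filter_pull[OF F] A.KS_pt_in_points by blast
  then show ?thesis
    using True B.KS_pt_in_points[OF F] by (simp add: KS_map_def KS_map_tilde_pt[OF F] KS_points_def)
next
  case False
  then have "KS_map_tilde A \<phi> f (B.KS_pt F y) = KS_infty A"
    unfolding KS_map_tilde_pt[OF F] by (intro KS_pt_pull_empty) blast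
  then show ?thesis
    using False by (simp add: KS_map_def KS_points_def)
qed

lemma dom_KS_map: "dom (KS_map A B \<phi> f) = (\<Union>e\<in>A.E. KS_dom B (\<phi> e))"
proof (rule Set.set_eqI)
  fix \<omega>
  show "\<omega> \<in> dom (KS_map A B \<phi> f) \<longleftrightarrow> \<omega> \<in> (\<Union>e\<in>A.E. KS_dom B (\<phi> e))"
  proof (cases "\<omega> \<in> KS_points B")
    case True
    then obtain F y where F: "B.pointed_filter F y" "\<omega> = B.KS_pt F y"
      by (rule B.KS_pointE)
    show ?thesis
      using KS_map_pt[OF F(1)] B.KS_pt_in_dom_iff[OF F(1)] by (simp add: F(2) dom_def)
  next
    case False
    then show ?thesis
      using KS_map_outside B.KS_dom_subset by (auto simp: dom_def)
  qed
qed

text \<open>Properness of \<open>f\<close> is what makes the extension of \<open>f : Y\<^bsub>\<phi>(e)\<^esub> \<rightarrow> X\<^sub>e\<close> to the one-point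
  compactifications continuous at infinity; the preimage under \<open>f\<close> of a compact subset of \<open>X\<^sub>e\<close> lies
  in \<open>Y\<^bsub>\<phi>(e)\<^esub>\<close> because \<open>Y\<^bsub>\<phi>(e)\<^esub>\<close> is the preimage of \<open>X\<^sub>e\<close>.\<close>

lemma continuous_map_KS_map_tilde: "continuous_map B.P A.P (KS_map_tilde A \<phi> f)"
proof -
  have "continuous_map B.P (A.AC e) (\<lambda>\<omega>. KS_map_tilde A \<phi> f \<omega> e)" if e: "e \<in> A.E" for e
  proof -
    let ?Y = "subtopology B.X (B.D (\<phi> e))" and ?X = "subtopology A.X (A.D e)"
    have tY: "topspace ?Y = B.D (\<phi> e)"
      using B.dom_at_subset[OF hom_idem[OF e]] by auto
    have fY: "y \<in> dom f" "the (f y) \<in> A.D e" if "y \<in> B.D (\<phi> e)" for y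
      using preim_dom_at[OF e] that by (auto simp: preim_def)
    have "continuous_map (subtopology B.X (dom f)) A.X (\<lambda>y. the (f y))"
      using partial by (simp add: partial_map_def)
    then have "continuous_map ?Y A.X (\<lambda>y. the (f y))"
      by (rule continuous_map_from_subtopology_mono) (use fY in blast)
    then have cont: "continuous_map ?Y ?X (\<lambda>y. the (f y))"
      by (rule continuous_map_into_subtopology) (use fY tY in blast)
    have "continuous_map (B.AC (\<phi> e)) (A.AC e) (map_option (\<lambda>y. the (f y)))"
    proof (rule continuous_map_Alexandroff_map_option[OF cont])
      fix K assume "compactin ?X K"
      then have K: "compactin A.X K" "K \<subseteq> A.D e"
        by (simp_all add: compactin_subtopology)
      then have "compactin B.X (preim f K)"
        using proper by (simp add: proper_partial_map_def compactin_subtopology)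
      moreover have "{y \<in> topspace ?Y. the (f y) \<in> K} = preim f K"
        unfolding tY using preim_dom_at[OF e] K(2) by (auto simp: preim_def)
      moreover have "preim f K \<subseteq> B.D (\<phi> e)"
        using preim_dom_at[OF e] K(2) by (auto simp: preim_def)
      ultimately show "compactin ?Y {y \<in> topspace ?Y. the (f y) \<in> K}"
        by (simp add: compactin_subtopology)
    qed
    with B.continuous_map_coord[OF hom_idem[OF e]]
    have "continuous_map B.P (A.AC e) (map_option (\<lambda>y. the (f y)) \<circ> (\<lambda>\<omega>. \<omega> (\<phi> e)))"
      by (rule continuous_map_compose)
    then show ?thesis
    proof (rule continuous_map_eq)
      fix \<omega> assume "\<omega> \<in> topspace B.P"
      then have "\<omega> (\<phi> e) \<in> insert None (Some ` B.D (\<phi> e))"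
        using hom_idem[OF e] unfolding B.topspace_KS_prod by (rule PiE_mem)
      then show "(map_option (\<lambda>y. the (f y)) \<circ> (\<lambda>\<omega>. \<omega> (\<phi> e))) \<omega> = KS_map_tilde A \<phi> f \<omega> e"
        using e fY(1) by (auto simp: KS_map_tilde_def domIff)
    qed
  qed
  then show ?thesis
    unfolding KS_prod_def[of A] continuous_map_componentwise
    by (auto simp: KS_map_tilde_def)
qed

lemma KS_map_eq: "\<omega> \<in> dom (KS_map A B \<phi> f) \<Longrightarrow> the (KS_map A B \<phi> f \<omega>) = KS_map_tilde A \<phi> f \<omega>"
  and dom_KS_map_alt:
    "dom (KS_map A B \<phi> f) = {\<omega> \<in> KS_tilde B. KS_map_tilde A \<phi> f \<omega> \<in> KS_points A}"
  by (auto simp: KS_map_def dom_def)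

lemma dom_KS_map_subset: "dom (KS_map A B \<phi> f) \<subseteq> KS_points B"
  unfolding dom_KS_map using B.KS_dom_subset by blast

lemma partial_map_KS_map:
  "partial_map (subtopology B.P (KS_points B)) (subtopology A.P (KS_points A)) (KS_map A B \<phi> f)"
  unfolding partial_map_def
proof
  let ?d = "dom (KS_map A B \<phi> f)" and ?Z = "subtopology B.P (KS_points B)"
  show "openin ?Z ?d"
    unfolding dom_KS_map using B.openin_KS_dom by (intro openin_Union) auto
  have sub: "subtopology ?Z ?d = subtopology B.P ?d"
    using dom_KS_map_subset by (simp add: subtopology_subtopology inf.absorb2)
  have "continuous_map (subtopology B.P ?d) (subtopology A.P (KS_points A)) (KS_map_tilde A \<phi> f)"
    using continuous_map_KS_map_tilde dom_KS_map_alt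
    by (intro continuous_map_into_subtopology continuous_map_from_subtopology) auto
  then show "continuous_map (subtopology ?Z ?d) (subtopology A.P (KS_points A))
      (\<lambda>\<omega>. the (KS_map A B \<phi> f \<omega>))"
    unfolding sub by (rule continuous_map_eq) (simp add: KS_map_eq)
qed

text \<open>A compact subset of \<open>X\<^sup>K\<^sup>S\<close> is closed in the product, so its preimage is closed in the compact
  space that \<open>Y\<^sup>K\<^sup>S\<close> is obtained from by removing \<open>\<infinity>\<close>; and \<open>\<infinity>\<close> is not in the preimage because it is
  mapped to \<open>\<infinity>\<close>.\<close>

lemma proper_KS_map:
  "proper_partial_map (subtopology B.P (KS_points B)) (subtopology A.P (KS_points A)) (KS_map A B \<phi> f)"
  unfolding proper_partial_map_def
proof (intro allI impI)
  let ?d = "dom (KS_map A B \<phi> f)"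
  fix K assume "compactin (subtopology A.P (KS_points A)) K"
  then have K: "compactin A.P K" "K \<subseteq> KS_points A"
    by (simp_all add: compactin_subtopology)
  have "closedin B.P {\<omega> \<in> topspace B.P. KS_map_tilde A \<phi> f \<omega> \<in> K}"
    using continuous_map_KS_map_tilde compactin_imp_closedin[OF A.Hausdorff_KS_prod K(1)]
    by (rule closedin_continuous_map_preimage)
  then have "closedin B.P (KS_tilde B \<inter> {\<omega> \<in> topspace B.P. KS_map_tilde A \<phi> f \<omega> \<in> K})"
    using B.closedin_KS_tilde by (intro closedin_Int)
  moreover have "KS_tilde B \<inter> {\<omega> \<in> topspace B.P. KS_map_tilde A \<phi> f \<omega> \<in> K} = preim (KS_map A B \<phi> f) K"
    using K(2) closedin_subset[OF B.closedin_KS_tilde]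
    by (auto simp: preim_def KS_map_eq dom_KS_map_alt)
  ultimately have "compactin B.P (preim (KS_map A B \<phi> f) K)"
    using B.compact_KS_prod closedin_compact_space by metis
  moreover have "preim (KS_map A B \<phi> f) K \<subseteq> ?d"
    by (auto simp: preim_def)
  ultimately show "compactin (subtopology (subtopology B.P (KS_points B)) ?d) (preim (KS_map A B \<phi> f) K)"
    using dom_KS_map_subset by (simp add: compactin_subtopology)
qed

lemma preim_KS_dom:
  assumes e: "e \<in> A.E"
  shows "preim (KS_map A B \<phi> f) (KS_dom A e) = KS_dom B (\<phi> e)"
proof (rule Set.set_eqI)
  fix \<omega>
  show "\<omega> \<in> preim (KS_map A B \<phi> f) (KS_dom A e) \<longleftrightarrow> \<omega> \<in> KS_dom B (\<phi> e)"
  proof (cases "\<omega> \<in> KS_points B")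
    case True
    then obtain F y where F: "B.pointed_filter F y" "\<omega> = B.KS_pt F y"
      by (rule B.KS_pointE)
    have "\<omega> \<in> preim (KS_map A B \<phi> f) (KS_dom A e) \<longleftrightarrow> \<phi> e \<in> F"
    proof (cases "\<exists>g\<in>A.E. \<phi> g \<in> F")
      case True
      then have "A.KS_pt (pull F) (the (f y)) \<in> KS_dom A e \<longleftrightarrow> e \<in> pull F"
        using A.KS_pt_in_dom_iff[OF pointed_filter_pull[OF F(1)] e] by blast
      then show ?thesis
        using True KS_map_pt[OF F(1)] e by (simp add: preim_def F(2) dom_def)
    next
      case False
      then show ?thesis
        using KS_map_pt[OF F(1)] e by (auto simp: preim_def F(2) dom_def)
    qed
    then show ?thesis
      using B.KS_pt_in_dom_iff[OF F(1) hom_idem[OF e]] by (simp add: F(2))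
  next
    case False
    then show ?thesis
      using KS_map_outside B.KS_dom_subset by (auto simp: preim_def)
  qed
qed

lemma KS_map_commute:
  assumes s: "s \<in> carrier A.S"
    and \<omega>: "\<omega> \<in> preim (KS_map A B \<phi> f) (KS_dom A (star A.S s \<otimes>\<^bsub>A.S\<^esub> s))"
  shows "(KS_act A s \<circ>\<^sub>m KS_map A B \<phi> f) \<omega> = (KS_map A B \<phi> f \<circ>\<^sub>m KS_act B (\<phi> s)) \<omega>"
proof -
  let ?g = "star A.S s \<otimes>\<^bsub>A.S\<^esub> s" and ?h = "star B.S (\<phi> s) \<otimes>\<^bsub>B.S\<^esub> \<phi> s"
  have g: "?g \<in> A.E" and h: "?h \<in> B.E"
    using s by simp_all
  have "\<omega> \<in> KS_dom B (\<phi> ?g)"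
    using \<omega> preim_KS_dom[OF g] by blast
  then obtain F y where F: "B.pointed_filter F y" "\<phi> ?g \<in> F" "\<omega> = B.KS_pt F y"
    using hom_idem[OF g] by (rule B.KS_domE)
  have hF: "?h \<in> F"
    using F(2) s by (simp add: hom_star_mult)
  obtain x where x: "f y = Some x" "x \<in> A.D ?g"
    using g B.pointed_filter_dom_at[OF F(1,2)] by (rule map_in_dom_at)
  have "y \<in> preim f (A.D ?g)"
    using x by (auto simp: preim_def)
  then have fy: "A.\<theta> s x = (f \<circ>\<^sub>m B.\<theta> (\<phi> s)) y"
    using act_commute[OF s] x(1) by fastforce
  let ?G = "{d \<in> B.E. star B.S (\<phi> s) \<otimes>\<^bsub>B.S\<^esub> d \<otimes>\<^bsub>B.S\<^esub> \<phi> s \<in> F}"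
  obtain y' where y': "B.\<theta> (\<phi> s) y = Some y'"
    using B.pointed_filter_dom_at[OF F(1) hF] B.act_defined_iff[OF hom_closed[OF s], of y] by blast
  have G: "B.pointed_filter ?G y'"
    using B.pointed_filter_act[OF F(1) hom_closed[OF s] hF] y' by simp
  have pull: "A.pointed_filter (pull F) x"
    using pointed_filter_pull[OF F(1) g F(2)] x(1) by simp
  have "(KS_act A s \<circ>\<^sub>m KS_map A B \<phi> f) \<omega> =
      Some (A.KS_pt {e \<in> A.E. star A.S s \<otimes>\<^bsub>A.S\<^esub> e \<otimes>\<^bsub>A.S\<^esub> s \<in> pull F} (the (A.\<theta> s x)))"
  proof -
    have "KS_map A B \<phi> f \<omega> = Some (A.KS_pt (pull F) x)"
      using KS_map_pt[OF F(1)] g F(2) x(1) by (auto simp: F(3))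
    then show ?thesis
      using A.KS_act_pt[OF pull s] g F(2) by simp
  qed
  also have "\<dots> = Some (A.KS_pt (pull ?G) (the (f y')))"
    using s fy y' by (auto simp: hom_conj intro: A.KS_pt_eqI)
  also have "\<dots> = (KS_map A B \<phi> f \<circ>\<^sub>m KS_act B (\<phi> s)) \<omega>"
  proof -
    have "s \<otimes>\<^bsub>A.S\<^esub> star A.S s \<in> pull ?G"
    proof -
      have "star A.S s \<otimes>\<^bsub>A.S\<^esub> (s \<otimes>\<^bsub>A.S\<^esub> star A.S s) \<otimes>\<^bsub>A.S\<^esub> s = ?g"
        using s by (simp add: A.assoc A.mult_star_mult)
      then show ?thesis
        using s F(2) hom_conj[OF s A.mult_star_idem[OF s]] by simp
    qed
    then have "KS_map A B \<phi> f (B.KS_pt ?G y') = Some (A.KS_pt (pull ?G) (the (f y')))"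
      using KS_map_pt[OF G] by auto
    moreover have "KS_act B (\<phi> s) \<omega> = Some (B.KS_pt ?G y')"
      using B.KS_act_pt[OF F(1) hom_closed[OF s]] hF y' by (simp add: F(3))
    ultimately show ?thesis
      by simp
  qed
  finally show ?thesis .
qed

lemma KS_mor_in_ISA_pr_hom: "(\<phi>, KS_map A B \<phi> f) \<in> ISA_pr_hom (KS_obj A) (KS_obj B)"
proof -
  have fields: "semig (KS_obj A) = A.S" "semig (KS_obj B) = B.S"
    "tspace (KS_obj A) = subtopology A.P (KS_points A)"
    "tspace (KS_obj B) = subtopology B.P (KS_points B)"
    "act (KS_obj A) = KS_act A" "act (KS_obj B) = KS_act B"
    by (simp_all add: KS_obj_def)
  have "preim (KS_map A B \<phi> f) (dom_at (KS_obj A) e) = dom_at (KS_obj B) (\<phi> e)" if "e \<in> A.E" for e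
    using preim_KS_dom[OF that] A.dom_at_KS_obj[OF that] B.dom_at_KS_obj[OF hom_idem[OF that]] by simp
  moreover have "(KS_act A s \<circ>\<^sub>m KS_map A B \<phi> f) \<omega> = (KS_map A B \<phi> f \<circ>\<^sub>m KS_act B (\<phi> s)) \<omega>"
    if "s \<in> carrier A.S" "\<omega> \<in> preim (KS_map A B \<phi> f) (dom_at (KS_obj A) (star A.S s \<otimes>\<^bsub>A.S\<^esub> s))" for s \<omega>
    using KS_map_commute[OF that(1)] that(2) A.dom_at_KS_obj[OF A.star_mult_idem[OF that(1)]] by simp
  ultimately show ?thesis
    unfolding ISA_pr_hom_def action_morphisms_def mem_Collect_eq case_prod_conv fields
    using hom partial_map_KS_map proper_KS_map by blast
qed

end

lemma proper_action_morphismI: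
  "A \<in> ISA_pr_obj \<Longrightarrow> B \<in> ISA_pr_obj \<Longrightarrow> m \<in> ISA_pr_hom A B \<Longrightarrow>
    proper_action_morphism A B (fst m) (snd m)"
  using lch_action_if_ISA_pr_obj[of A] lch_action_if_ISA_pr_obj[of B]
  by (simp add: proper_action_morphism_def proper_action_morphism_axioms_def)


section \<open>Functoriality\<close>

lemma (in lch_action) KS_mor_id: "KS_mor A A (ISA_id A) = ISA_id (KS_obj A)"
proof -
  let ?\<phi> = "\<lambda>s\<in>carrier S. s" and ?f = "Some |` topspace X"
  have "A \<in> ISA_pr_obj"
    using is_action lc Hausdorff by (simp add: ISA_pr_obj_def)
  then interpret proper_action_morphism A A ?\<phi> ?f
    using proper_action_morphismI[OF _ _ ISA_id_in_hom] by (simp add: ISA_id_def)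
  have "KS_map A A ?\<phi> ?f \<tau> = (Some |` KS_points A) \<tau>" for \<tau>
  proof (cases "\<tau> \<in> KS_points A")
    case True
    then obtain F x where F: "pointed_filter F x" "\<tau> = KS_pt F x"
      by (rule KS_pointE)
    have "?f x = Some x"
      using pointed_filter_topspace[OF F(1)] by simp
    moreover have "{e \<in> E. ?\<phi> e \<in> F} = F"
      using pointed_filter_subset[OF F(1)] by auto
    moreover have "\<exists>e\<in>E. ?\<phi> e \<in> F"
      using pointed_filter_nonempty[OF F(1)] by auto
    ultimately show ?thesis
      using KS_map_pt[OF F(1)] True by (simp only: F(2) restrict_in option.sel if_True)
  next
    case False
    then show ?thesis
      using KS_map_outside by simp
  qed
  then have "KS_map A A ?\<phi> ?f = Some |` KS_points A" ..
  then show ?thesis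
    using topspace_KS by (simp add: KS_mor_def ISA_id_def KS_obj_def)
qed

lemma KS_mor_comp:
  assumes A: "A \<in> ISA_pr_obj" and B: "B \<in> ISA_pr_obj" and C: "C \<in> ISA_pr_obj"
    and m: "m \<in> ISA_pr_hom A B" and n: "n \<in> ISA_pr_hom B C"
  shows "KS_mor A C (ISA_comp A n m) = ISA_comp (KS_obj A) (KS_mor B C n) (KS_mor A B m)"
proof -
  obtain \<phi> f \<psi> g where mn: "m = (\<phi>, f)" "n = (\<psi>, g)" by fastforce
  let ?\<chi> = "compose (carrier (semig A)) \<psi> \<phi>"
  interpret AB: proper_action_morphism A B \<phi> f
    using proper_action_morphismI[OF A B m] by (simp add: mn)
  interpret BC: proper_action_morphism B C \<psi> g
    using proper_action_morphismI[OF B C n] by (simp add: mn)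
  interpret AC: proper_action_morphism A C ?\<chi> "f \<circ>\<^sub>m g"
    using proper_action_morphismI[OF A C ISA_comp_in_hom[OF A B C m n]] by (simp add: mn ISA_comp_def)
  have "KS_map A C ?\<chi> (f \<circ>\<^sub>m g) \<omega> = (KS_map A B \<phi> f \<circ>\<^sub>m KS_map B C \<psi> g) \<omega>" for \<omega>
  proof (cases "\<omega> \<in> KS_points C")
    case True
    then obtain F z where F: "BC.B.pointed_filter F z" "\<omega> = BC.B.KS_pt F z"
      by (rule BC.B.KS_pointE)
    have pull: "AC.pull F = AB.pull (BC.pull F)"
      by (auto simp: compose_def)
    have ex: "(\<exists>e\<in>AB.A.E. ?\<chi> e \<in> F) \<longleftrightarrow> (\<exists>e\<in>AB.A.E. \<phi> e \<in> BC.pull F)"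
      by (auto simp: compose_def)
    note AC = AC.KS_map_pt[OF F(1), unfolded ex pull]
    show ?thesis
    proof (cases "\<exists>d\<in>AB.B.E. \<psi> d \<in> F")
      case True
      then obtain d where d: "d \<in> AB.B.E" "\<psi> d \<in> F" by blast
      obtain y where y: "g z = Some y"
        using d(1) BC.B.pointed_filter_dom_at[OF F(1) d(2)] by (rule BC.map_in_dom_at)
      have "AB.B.pointed_filter (BC.pull F) y"
        using BC.pointed_filter_pull[OF F(1) d] y by simp
      from AB.KS_map_pt[OF this] BC.KS_map_pt[OF F(1)] show ?thesis
        using AC True y by (simp add: F(2))
    next
      case False
      then have none: "\<not> (\<exists>e\<in>AB.A.E. \<phi> e \<in> BC.pull F)"
        using AB.hom_idem by blast
      show ?thesis
        using AC BC.KS_map_pt[OF F(1)] unfolding if_not_P[OF none] if_not_P[OF False] by (simp add: F(2))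
    qed
  next
    case False
    then show ?thesis
      using AC.KS_map_outside BC.KS_map_outside by simp
  qed
  then have "KS_map A C ?\<chi> (f \<circ>\<^sub>m g) = KS_map A B \<phi> f \<circ>\<^sub>m KS_map B C \<psi> g" ..
  then show ?thesis
    by (simp add: mn KS_mor_def ISA_comp_def KS_obj_def)
qed

theorem theorem3p2p6:
  shows
    "(\<forall>A \<in> (ISA_pr_obj :: ('s, 'x) isaction set). KS_obj A \<in> ISA_pr_obj) \<and>
     (\<forall>A \<in> (ISA_pr_obj :: ('s, 'x) isaction set).
      \<forall>B \<in> (ISA_pr_obj :: ('t, 'y) isaction set).
      \<forall>m \<in> ISA_pr_hom A B.
        KS_mor A B m \<in> ISA_pr_hom (KS_obj A) (KS_obj B)) \<and>
     (\<forall>A \<in> (ISA_pr_obj :: ('s, 'x) isaction set).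
        KS_mor A A (ISA_id A) = ISA_id (KS_obj A)) \<and>
     (\<forall>A \<in> (ISA_pr_obj :: ('s, 'x) isaction set).
      \<forall>B \<in> (ISA_pr_obj :: ('t, 'y) isaction set).
      \<forall>C \<in> (ISA_pr_obj :: ('u, 'z) isaction set).
      \<forall>m \<in> ISA_pr_hom A B. \<forall>n \<in> ISA_pr_hom B C.
        KS_mor A C (ISA_comp A n m) =
        ISA_comp (KS_obj A) (KS_mor B C n) (KS_mor A B m))"
proof (intro conjI ballI)
  fix A :: "('s, 'x) isaction" assume "A \<in> ISA_pr_obj"
  then interpret lch_action A by (rule lch_action_if_ISA_pr_obj)
  show "KS_obj A \<in> ISA_pr_obj" by (rule KS_obj_in_ISA_pr_obj)
  show "KS_mor A A (ISA_id A) = ISA_id (KS_obj A)" by (rule KS_mor_id)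
next
  fix A :: "('s, 'x) isaction" and B :: "('t, 'y) isaction" and m
  assume "A \<in> ISA_pr_obj" "B \<in> ISA_pr_obj" "m \<in> ISA_pr_hom A B"
  then interpret proper_action_morphism A B "fst m" "snd m" by (rule proper_action_morphismI)
  show "KS_mor A B m \<in> ISA_pr_hom (KS_obj A) (KS_obj B)"
    unfolding KS_mor_def by (rule KS_mor_in_ISA_pr_hom)
qed (rule KS_mor_comp)

end
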